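(* Let $m<n$ be positive integers, let $A\in\mathbb{R}^{n\times n}$ be symmetric positive semidefinite with $n-m\le\operatorname{rank}(A)\le n$, let $B\in\mathbb{R}^{m\times n}$ have full row rank, and suppose that the matrix $$\mathcal{K}=\begin{bmatrix}A & B^T\\ B & 0\end{bmatrix}\in\mathbb{R}^{(n+m)\times(n+m)}$$ is invertible. Let $\mu_1\ge\mu_2\ge\cdots\ge\mu_n$ be the eigenvalues of $A$ (with multiplicity), and let $u_1,\dots,u_n$ be an orthonormal basis of $\mathbb{R}^n$ with $Au_i=\mu_iu_i$. Let $\sigma_{\min}$ be the smallest singular value of $B$, and let $\tilde\theta_{\min}$ be the smallest principal angle between $\operatorname{range}(B^T)$ and $\operatorname{span}\{u_1,\dots,u_{n-m}\}$, the subspace spanned by the eigenvectors corresponding to the $n-m$ largest eigenvalues of $A$. Then every positive eigenvalue of $\mathcal{K}$ is greater than or equal to $$\min\left\{\mu_{n-m}\,(1-\cos(\tilde\theta_{\min})),\ \sigma_{\min}\sqrt{1-\cos(\tilde\theta_{\min})}\right\}.$$ Moreover, $\tilde\theta_{\min}$ is equivalently the smallest principal angle between $\ker(B)$ and $\operatorname{span}\{u_{n-m+1},\dots,u_n\}$, the subspace spanned by the eigenvectors corresponding to the $m$ smallest eigenvalues of $A$.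
   Context: The singular values of $B\in\mathbb{R}^{m\times n}$ (with $m<n$) are its $m$ singular values $\sigma_1\ge\cdots\ge\sigma_m\ge 0$, and $\sigma_{\min}=\sigma_m$. For nonzero subspaces $X,Y\subseteq\mathbb{R}^n$ with matrices $U$, $V$ whose columns are orthonormal bases of $X$ and $Y$, the cosines of the principal angles (in $[0,\pi/2]$) between $X$ and $Y$ are the singular values of $U^TV$; thus the smallest principal angle $\theta$ between them satisfies $\cos(\theta)=\|U^TV\|_2$, the largest singular value of $U^TV$. *)

theory Defs
  imports
    "Jordan_Normal_Form.DL_Rank"
    "Jordan_Normal_Form.Matrix_Kernel"
    "Jordan_Normal_Form.Spectral_Radius"
begin

text \<open>The span inside \<open>\<real>\<^sup>n\<close>, as \<open>span\<close> in \<^locale>\<open>vec_space\<close> but usable outside the locale.\<close>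

abbreviation span_vec :: "nat \<Rightarrow> real vec set \<Rightarrow> real vec set" where
  "span_vec n S \<equiv> LinearCombinations.module.span class_ring (module_vec TYPE(real) n) S"

definition positive_semidefinite_mat :: "real mat \<Rightarrow> bool" where
  "positive_semidefinite_mat M \<longleftrightarrow>
     square_mat M \<and> (\<forall>x \<in> carrier_vec (dim_row M). 0 \<le> x \<bullet> (M *\<^sub>v x))"

text \<open>A \<open>p \<times> q\<close> matrix has \<open>min p q\<close> singular values. Taking the Gram matrix of
  that size matters: the larger one has additional zero eigenvalues which
  do not count as singular values, and would make every smallest singular value of a
  non-square matrix zero. Multiplicities are not recorded.\<close>

definition singular_values :: "real mat \<Rightarrow> real set" where
  "singular_values M =
     sqrt ` spectrum (if dim_row M \<le> dim_col M then M * M\<^sup>T else M\<^sup>T * M)"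

definition orthonormal_basis_mat :: "nat \<Rightarrow> real vec set \<Rightarrow> real mat \<Rightarrow> bool" where
  "orthonormal_basis_mat n X U \<longleftrightarrow>
     dim_row U = n \<and> U\<^sup>T * U = 1\<^sub>m (dim_col U) \<and> vec_space.col_space n U = X"

text \<open>The singular values of \<open>U\<^sup>T V\<close> do not depend on the choice of the
  orthonormal bases, so the set below consists of the principal angles for any one choice.\<close>

definition principal_angles :: "nat \<Rightarrow> real vec set \<Rightarrow> real vec set \<Rightarrow> real set" where
  "principal_angles n X Y =
     {\<theta> \<in> {0..pi/2}. \<exists>U V. orthonormal_basis_mat n X U \<and> orthonormal_basis_mat n Y V \<and>
        cos \<theta> \<in> singular_values (U\<^sup>T * V)}"

definition smallest_principal_angle :: "nat \<Rightarrow> real vec set \<Rightarrow> real vec set \<Rightarrow> real" where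
  "smallest_principal_angle n X Y = Min (principal_angles n X Y)"

end

theory Submission
  imports Defs
begin

text \<open>
  Let \<open>X\<close> be the row space of \<open>B\<close> and \<open>Y\<close> the span of the leading \<open>n - m\<close> eigenvectors of \<open>A\<close>, with
  orthogonal projections \<open>P\<close> and \<open>Q\<close>, and let \<open>c\<close> be the cosine of the smallest principal angle between
  them.

  Eliminating the lower component of an eigenvector of the saddle point matrix gives
  \<open>t\<^sup>2 (x \<bullet> x) = t (x \<bullet> A x) + B x \<bullet> B x\<close> for some \<open>x \<noteq> 0\<close> (\<open>saddle_point_eigenvalue\<close>).  Here \<open>x \<bullet> A x\<close>
  is at least \<open>\<mu> (n - m)\<close> times the squared length of \<open>Q x\<close> (\<open>form_ge_top_eigenspace\<close>), and \<open>B x \<bullet> B x\<close>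
  is at least \<open>\<sigma>_min\<^sup>2\<close> times that of \<open>P x\<close> (\<open>min_singular_value_row_space\<close>).  The bound on \<open>t\<close> follows as
  soon as the two squared lengths together are at least \<open>(1 - c) (x \<bullet> x)\<close>.

  This last inequality says that no vector is nearly orthogonal to both \<open>X\<close> and \<open>Y\<close>, so it is a statement
  about the orthogonal complements: the squared lengths of the projections of \<open>x\<close> to them add up to at
  most \<open>(1 + c) (x \<bullet> x)\<close>, which is Cauchy--Schwarz combined with the bound \<open>c\<close> for the cosines between the
  complements (\<open>projections_lower_bound\<close>).  Hence the second claim of the theorem, that the complements
  have the same smallest angle, is what makes the first one work.  It holds because the dimensions of \<open>X\<close>
  and of the complement of \<open>Y\<close> agree: for orthonormal bases \<open>U\<close>, \<open>V\<close> of \<open>X\<close>, \<open>Y\<close> and \<open>U'\<close>, \<open>V'\<close> of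
  their complements, the square matrix \<open>N = U\<^sup>T V'\<close> links the smaller Gram matrices of
  \<open>U\<^sup>T V\<close> and \<open>U'\<^sup>T V'\<close>, which are \<open>I - N N\<^sup>T\<close> and \<open>I - N\<^sup>T N\<close>
  (\<open>singular_values_complementary\<close>).

  The extreme singular values are reached variationally: the best lower bound of a real quadratic form
  is an eigenvalue of its matrix (\<open>symmetric_min_eigenvalue\<close>).  Dimensions are counted by traces of
  orthogonal projections.
\<close>

section \<open>Quadratic forms and extreme eigenvalues\<close>

lemma scalar_prod_self_nonneg:
  fixes x :: "real vec"
  shows "0 \<le> x \<bullet> x"
  by (simp add: scalar_prod_def sum_nonneg)

lemma scalar_prod_self_eq_0:
  fixes x :: "real vec"
  assumes "x \<in> carrier_vec n" and "x \<bullet> x = 0"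
  shows "x = 0\<^sub>v n"
proof -
  have "\<forall>i\<in>{0..<n}. x $ i * x $ i = 0"
    using assms sum_nonneg_eq_0_iff[of "{0..<n}" "\<lambda>i. x $ i * x $ i"] by (auto simp: scalar_prod_def)
  then show ?thesis using assms(1) by (intro eq_vecI) auto
qed

lemma scalar_prod_self_pos:
  fixes x :: "real vec"
  assumes "x \<in> carrier_vec n" and "x \<noteq> 0\<^sub>v n"
  shows "0 < x \<bullet> x"
  using scalar_prod_self_nonneg[of x] scalar_prod_self_eq_0[OF assms(1)] assms(2) by fastforce

lemma minus_vec_eq_0:
  fixes x y :: "real vec"
  assumes "x \<in> carrier_vec n" and "y \<in> carrier_vec n" and "x - y = 0\<^sub>v n"
  shows "x = y"
proof (rule eq_vecI)
  fix i assume "i < dim_vec y"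
  then show "x $ i = y $ i" using arg_cong[OF assms(3), of "\<lambda>v. v $ i"] assms(1,2) by simp
qed (use assms in simp)

lemma scalar_prod_mult_mat_vec:
  fixes M :: "real mat"
  assumes "M \<in> carrier_mat a b" and "x \<in> carrier_vec a" and "y \<in> carrier_vec b"
  shows "x \<bullet> (M *\<^sub>v y) = (M\<^sup>T *\<^sub>v x) \<bullet> y"
  using transpose_vec_mult_scalar[OF assms(1,3,2)] by simp

lemma quadratic_nonneg_discriminant:
  fixes a b d :: real
  assumes nonneg: "\<And>t. 0 \<le> a - 2 * t * b + t\<^sup>2 * d" and "0 \<le> d"
  shows "b\<^sup>2 \<le> a * d"
proof (cases "d = 0")
  case True
  have "b = 0"
  proof (rule ccontr)
    assume "b \<noteq> 0"
    then show False
      using nonneg[of "(a + 1) / (2 * b)"] True by simp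
  qed
  then show ?thesis using True by simp
next
  case False
  with \<open>0 \<le> d\<close> have "0 < d" by simp
  then show ?thesis
    using nonneg[of "b / d"] by (simp add: field_simps power2_eq_square)
qed

text \<open>The form of a positive semidefinite matrix is a possibly degenerate inner product, so it obeys
  the Cauchy--Schwarz inequality.\<close>

lemma psd_form_Cauchy_Schwarz:
  fixes M :: "real mat"
  assumes M: "M \<in> carrier_mat n n" and sym: "M\<^sup>T = M"
    and psd: "\<And>z. z \<in> carrier_vec n \<Longrightarrow> 0 \<le> z \<bullet> (M *\<^sub>v z)"
    and x: "x \<in> carrier_vec n" and y: "y \<in> carrier_vec n"
  shows "(x \<bullet> (M *\<^sub>v y))\<^sup>2 \<le> (x \<bullet> (M *\<^sub>v x)) * (y \<bullet> (M *\<^sub>v y))"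
proof (rule quadratic_nonneg_discriminant)
  fix t :: real
  have Mx: "M *\<^sub>v x \<in> carrier_vec n" and My: "M *\<^sub>v y \<in> carrier_vec n"
    using M x y by auto
  have yx: "y \<bullet> (M *\<^sub>v x) = x \<bullet> (M *\<^sub>v y)"
    using scalar_prod_mult_mat_vec[OF M y x] sym comm_scalar_prod[OF x My] by simp
  have "0 \<le> (x - t \<cdot>\<^sub>v y) \<bullet> (M *\<^sub>v (x - t \<cdot>\<^sub>v y))"
    using psd x y by simp
  also have "M *\<^sub>v (x - t \<cdot>\<^sub>v y) = M *\<^sub>v x - t \<cdot>\<^sub>v (M *\<^sub>v y)"
    using mult_minus_distrib_mat_vec[OF M x, of "t \<cdot>\<^sub>v y"] mult_mat_vec[OF M y] y by simp
  also have "(x - t \<cdot>\<^sub>v y) \<bullet> \<dots> = x \<bullet> (M *\<^sub>v x) - 2 * t * (x \<bullet> (M *\<^sub>v y)) + t\<^sup>2 * (y \<bullet> (M *\<^sub>v y))"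
    using x y Mx My yx
    by (simp add: minus_scalar_prod_distrib[of _ n] scalar_prod_minus_distrib[of _ n]
        power2_eq_square algebra_simps)
  finally show "0 \<le> \<dots>" .
qed (rule psd[OF y])

lemma scalar_prod_Cauchy_Schwarz:
  fixes x y :: "real vec"
  assumes "x \<in> carrier_vec n" and "y \<in> carrier_vec n"
  shows "(x \<bullet> y)\<^sup>2 \<le> (x \<bullet> x) * (y \<bullet> y)"
  using psd_form_Cauchy_Schwarz[of "1\<^sub>m n" n x y] assms scalar_prod_self_nonneg by simp

lemma form_bounded:
  fixes M :: "real mat"
  assumes M: "M \<in> carrier_mat n n"
  obtains C where "0 < C" and "\<And>x. x \<in> carrier_vec n \<Longrightarrow> \<bar>x \<bullet> (M *\<^sub>v x)\<bar> \<le> C * (x \<bullet> x)"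
proof
  let ?S = "\<Sum>i\<in>{0..<n}. \<Sum>j\<in>{0..<n}. \<bar>M $$ (i, j)\<bar>"
  show "0 < ?S + 1" by (smt (verit) abs_ge_zero sum_nonneg)
  fix x :: "real vec" assume x: "x \<in> carrier_vec n"
  have le: "x $ i * x $ i \<le> x \<bullet> x" if "i < n" for i
    using member_le_sum[of i "{0..<n}" "\<lambda>i. x $ i * x $ i"] that x by (auto simp: scalar_prod_def)
  have prod_le: "\<bar>x $ i\<bar> * \<bar>x $ j\<bar> \<le> x \<bullet> x" if "i < n" "j < n" for i j
  proof -
    have "0 \<le> (\<bar>x $ i\<bar> - \<bar>x $ j\<bar>)\<^sup>2" by simp
    then have "2 * (\<bar>x $ i\<bar> * \<bar>x $ j\<bar>) \<le> x $ i * x $ i + x $ j * x $ j"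
      by (simp add: power2_eq_square algebra_simps)
    then show ?thesis using le[OF that(1)] le[OF that(2)] by linarith
  qed
  have "x \<bullet> (M *\<^sub>v x) = (\<Sum>i\<in>{0..<n}. \<Sum>j\<in>{0..<n}. x $ i * (M $$ (i, j) * x $ j))"
    using M x by (simp add: scalar_prod_def row_def sum_distrib_left)
  also have "\<bar>\<dots>\<bar> \<le> (\<Sum>i\<in>{0..<n}. \<Sum>j\<in>{0..<n}. \<bar>x $ i * (M $$ (i, j) * x $ j)\<bar>)"
    by (rule order_trans[OF sum_abs sum_mono[OF sum_abs]])
  also have "\<dots> \<le> (\<Sum>i\<in>{0..<n}. \<Sum>j\<in>{0..<n}. \<bar>M $$ (i, j)\<bar> * (x \<bullet> x))"
  proof (intro sum_mono)
    fix i j assume "i \<in> {0..<n}" "j \<in> {0..<n}"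
    then have "\<bar>M $$ (i, j)\<bar> * (\<bar>x $ i\<bar> * \<bar>x $ j\<bar>) \<le> \<bar>M $$ (i, j)\<bar> * (x \<bullet> x)"
      by (intro mult_left_mono prod_le) auto
    then show "\<bar>x $ i * (M $$ (i, j) * x $ j)\<bar> \<le> \<bar>M $$ (i, j)\<bar> * (x \<bullet> x)"
      by (simp add: abs_mult ac_simps)
  qed
  also have "\<dots> = ?S * (x \<bullet> x)" by (simp add: sum_distrib_right)
  also have "\<dots> \<le> (?S + 1) * (x \<bullet> x)"
    using scalar_prod_self_nonneg[of x] by (simp add: algebra_simps)
  finally show "\<bar>x \<bullet> (M *\<^sub>v x)\<bar> \<le> (?S + 1) * (x \<bullet> x)" .
qed

text \<open>With an inverse \<open>N\<close> of \<open>M\<close>, Cauchy--Schwarz for the form of \<open>M\<close>, applied to \<open>x\<close> and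
  \<open>N x\<close>, bounds \<open>(x \<bullet> x)\<^sup>2\<close> by the product of \<open>x \<bullet> M x\<close> and \<open>N x \<bullet> x\<close>, and the second factor is at
  most a multiple of \<open>x \<bullet> x\<close>.\<close>

lemma nonsingular_psd_form_coercive:
  fixes M :: "real mat"
  assumes M: "M \<in> carrier_mat n n" and sym: "M\<^sup>T = M"
    and psd: "\<And>z. z \<in> carrier_vec n \<Longrightarrow> 0 \<le> z \<bullet> (M *\<^sub>v z)"
    and det: "det M \<noteq> 0"
  obtains \<delta> where "0 < \<delta>" and "\<And>x. x \<in> carrier_vec n \<Longrightarrow> \<delta> * (x \<bullet> x) \<le> x \<bullet> (M *\<^sub>v x)"
proof -
  obtain N where N: "N \<in> carrier_mat n n" and MN: "M * N = 1\<^sub>m n"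
    using det_non_zero_imp_unit[OF M det, of undefined]
    by (auto simp: Units_def ring_mat_simps)
  obtain C where C: "0 < C" "\<And>x. x \<in> carrier_vec n \<Longrightarrow> \<bar>x \<bullet> (N *\<^sub>v x)\<bar> \<le> C * (x \<bullet> x)"
    using form_bounded[OF N] by blast
  have "1 / C * (x \<bullet> x) \<le> x \<bullet> (M *\<^sub>v x)" if x: "x \<in> carrier_vec n" for x
  proof (cases "x = 0\<^sub>v n")
    case True
    then show ?thesis using psd[OF x] by simp
  next
    case False
    then have pos: "0 < x \<bullet> x" by (rule scalar_prod_self_pos[OF x])
    have Nx: "N *\<^sub>v x \<in> carrier_vec n" using N x by simp
    have MNx: "M *\<^sub>v (N *\<^sub>v x) = x"
      using assoc_mult_mat_vec[OF M N x] MN x by simp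
    have "(x \<bullet> x)\<^sup>2 \<le> (x \<bullet> (M *\<^sub>v x)) * ((N *\<^sub>v x) \<bullet> x)"
      using psd_form_Cauchy_Schwarz[OF M sym psd x Nx] MNx by simp
    also have "\<dots> \<le> (x \<bullet> (M *\<^sub>v x)) * (C * (x \<bullet> x))"
      using C(2)[OF x] comm_scalar_prod[OF Nx x] by (intro mult_left_mono psd x) simp
    finally have "x \<bullet> x \<le> (x \<bullet> (M *\<^sub>v x)) * C"
      using pos by (simp add: power2_eq_square mult.assoc[symmetric])
    then show ?thesis using C(1) by (simp add: field_simps)
  qed
  then show thesis using that[of "1 / C"] C(1) by simp
qed

text \<open>The supremum of the numbers \<open>t\<close> for which \<open>G - t I\<close> is positive semidefinite is attained.  At
  the supremum \<open>G - t I\<close> is singular, since otherwise its form would be coercive and \<open>t\<close> could be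
  increased.  So the best lower bound of the Rayleigh quotient is an eigenvalue.\<close>

lemma symmetric_min_eigenvalue:
  fixes G :: "real mat"
  assumes G: "G \<in> carrier_mat k k" and sym: "G\<^sup>T = G" and k: "0 < k"
  obtains \<nu> where "\<nu> \<in> spectrum G"
    and "\<And>x. x \<in> carrier_vec k \<Longrightarrow> \<nu> * (x \<bullet> x) \<le> x \<bullet> (G *\<^sub>v x)"
proof -
  define T where "T = {t. \<forall>x\<in>carrier_vec k. t * (x \<bullet> x) \<le> x \<bullet> (G *\<^sub>v x)}"
  define s where "s = Sup T"
  obtain C where C: "\<And>x. x \<in> carrier_vec k \<Longrightarrow> \<bar>x \<bullet> (G *\<^sub>v x)\<bar> \<le> C * (x \<bullet> x)"
    using form_bounded[OF G] by blast
  have "- C \<in> T"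
    using C unfolding T_def by (fastforce simp: abs_le_iff)
  then have T_ne: "T \<noteq> {}" by blast
  have upper: "t \<le> x \<bullet> (G *\<^sub>v x) / (x \<bullet> x)"
    if "t \<in> T" "x \<in> carrier_vec k" "x \<noteq> 0\<^sub>v k" for t x
    using that scalar_prod_self_pos[OF that(2,3)] by (simp add: T_def field_simps)
  have "unit_vec k 0 \<noteq> (0\<^sub>v k :: real vec)" using k
    by (metis index_unit_vec(1) index_zero_vec(1) zero_neq_one)
  then have bdd: "bdd_above T" using upper[of _ "unit_vec k 0"] k unfolding bdd_above_def by auto
  have s: "s * (x \<bullet> x) \<le> x \<bullet> (G *\<^sub>v x)" if x: "x \<in> carrier_vec k" for x
  proof (cases "x = 0\<^sub>v k")
    case True
    then show ?thesis using G by simp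
  next
    case False
    have "s \<le> x \<bullet> (G *\<^sub>v x) / (x \<bullet> x)"
      unfolding s_def by (rule cSup_least[OF T_ne]) (rule upper[OF _ x False])
    then show ?thesis using scalar_prod_self_pos[OF x False] by (simp add: field_simps)
  qed
  have "s \<in> spectrum G"
  proof (rule ccontr)
    assume not_ev: "s \<notin> spectrum G"
    define M where "M = char_matrix G s"
    have M: "M \<in> carrier_mat k k" using G by (simp add: M_def)
    have M_vec: "M *\<^sub>v x = G *\<^sub>v x - s \<cdot>\<^sub>v x" if x: "x \<in> carrier_vec k" for x
      using G x by (intro eq_vecI) (auto simp: M_def char_matrix_def add_mult_distrib_mat_vec[of _ k k])
    have M_form: "x \<bullet> (M *\<^sub>v x) = x \<bullet> (G *\<^sub>v x) - s * (x \<bullet> x)" if x: "x \<in> carrier_vec k" for x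
      using G x by (simp add: M_vec scalar_prod_minus_distrib[of _ k])
    have M_sym: "M\<^sup>T = M"
    proof (rule eq_matI)
      fix i j assume "i < dim_row M" "j < dim_col M"
      moreover from this have "G $$ (j, i) = G $$ (i, j)"
        using M G arg_cong[OF sym, of "\<lambda>X. X $$ (i, j)"] by auto
      ultimately show "M\<^sup>T $$ (i, j) = M $$ (i, j)"
        using G by (auto simp: M_def char_matrix_def)
    qed (use M in auto)
    have "det M \<noteq> 0"
      using not_ev eigenvalue_det[OF G] by (simp add: spectrum_def M_def)
    moreover have "0 \<le> x \<bullet> (M *\<^sub>v x)" if "x \<in> carrier_vec k" for x
      using s[OF that] M_form[OF that] by simp
    ultimately obtain \<delta> where \<delta>: "0 < \<delta>"
      "\<And>x. x \<in> carrier_vec k \<Longrightarrow> \<delta> * (x \<bullet> x) \<le> x \<bullet> (M *\<^sub>v x)"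
      using nonsingular_psd_form_coercive[OF M M_sym] by blast
    have "(s + \<delta>) * (x \<bullet> x) \<le> x \<bullet> (G *\<^sub>v x)" if "x \<in> carrier_vec k" for x
      using \<delta>(2)[OF that] M_form[OF that] by (simp add: distrib_right)
    then have "s + \<delta> \<in> T" by (simp add: T_def)
    then have "s + \<delta> \<le> s" unfolding s_def by (rule cSup_upper[OF _ bdd])
    with \<delta>(1) show False by simp
  qed
  with s show thesis using that by blast
qed

lemma symmetric_max_eigenvalue:
  fixes G :: "real mat"
  assumes G: "G \<in> carrier_mat k k" and sym: "G\<^sup>T = G" and k: "0 < k"
  obtains \<nu> where "\<nu> \<in> spectrum G"
    and "\<And>x. x \<in> carrier_vec k \<Longrightarrow> x \<bullet> (G *\<^sub>v x) \<le> \<nu> * (x \<bullet> x)"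
proof -
  have nG: "- G \<in> carrier_mat k k" and nsym: "(- G)\<^sup>T = - G"
    using G sym by (auto simp: transpose_uminus)
  have nG_vec: "(- G) *\<^sub>v x = - (G *\<^sub>v x)" if "x \<in> carrier_vec k" for x
    using that G by simp
  obtain \<nu> where ev: "\<nu> \<in> spectrum (- G)"
    and min: "\<And>x. x \<in> carrier_vec k \<Longrightarrow> \<nu> * (x \<bullet> x) \<le> x \<bullet> ((- G) *\<^sub>v x)"
    using symmetric_min_eigenvalue[OF nG nsym k] by blast
  obtain v where v: "v \<in> carrier_vec k" "v \<noteq> 0\<^sub>v k" "(- G) *\<^sub>v v = \<nu> \<cdot>\<^sub>v v"
    using ev G by (auto simp: spectrum_def eigenvalue_def eigenvector_def)
  have "G *\<^sub>v v = (- \<nu>) \<cdot>\<^sub>v v"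
  proof -
    have "- (G *\<^sub>v v) = \<nu> \<cdot>\<^sub>v v"
      by (rule trans[OF nG_vec[OF v(1), symmetric] v(3)])
    then have "G *\<^sub>v v = - (\<nu> \<cdot>\<^sub>v v)"
      by (metis uminus_uminus_vec)
    then show ?thesis
      by (intro eq_vecI) (simp_all add: G v(1) carrier_vecD[OF v(1)])
  qed
  then have "- \<nu> \<in> spectrum G"
    using v G by (auto simp: spectrum_def eigenvalue_def eigenvector_def)
  moreover have "x \<bullet> (G *\<^sub>v x) \<le> - \<nu> * (x \<bullet> x)" if "x \<in> carrier_vec k" for x
    using min[OF that] that G by (simp add: nG_vec)
  ultimately show thesis using that by blast
qed

section \<open>Singular values\<close>

lemma mem_spectrum_iff:
  assumes "A \<in> carrier_mat n n"
  shows "s \<in> spectrum A \<longleftrightarrow> (\<exists>v\<in>carrier_vec n. v \<noteq> 0\<^sub>v n \<and> A *\<^sub>v v = s \<cdot>\<^sub>v v)"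
  using assms by (auto simp: spectrum_def eigenvalue_def eigenvector_def)

lemma smult_vec_0:
  fixes v :: "real vec"
  assumes "v \<in> carrier_vec n"
  shows "0 \<cdot>\<^sub>v v = 0\<^sub>v n"
  using assms by (intro eq_vecI) auto

lemma mult_mat_zero_vec:
  fixes M :: "real mat"
  assumes "M \<in> carrier_mat a b"
  shows "M *\<^sub>v 0\<^sub>v b = 0\<^sub>v a"
  using assms by (intro eq_vecI) auto

text \<open>If \<open>N M v = s v\<close>, then \<open>M v\<close> is an eigenvector of \<open>M N\<close>; it is nonzero because \<open>s\<close> is.\<close>

lemma nonzero_spectrum_mult_commute:
  fixes M N :: "real mat"
  assumes N: "N \<in> carrier_mat a b" and M: "M \<in> carrier_mat b a"
    and s: "s \<in> spectrum (N * M)" "s \<noteq> 0"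
  shows "s \<in> spectrum (M * N)"
proof -
  obtain v where v: "v \<in> carrier_vec a" "v \<noteq> 0\<^sub>v a" "N * M *\<^sub>v v = s \<cdot>\<^sub>v v"
    using s mem_spectrum_iff[of "N * M" a s] M N by auto
  have Mv: "M *\<^sub>v v \<in> carrier_vec b" using M v by simp
  have NMv: "N *\<^sub>v (M *\<^sub>v v) = s \<cdot>\<^sub>v v"
    using assoc_mult_mat_vec[OF N M v(1)] v(3) by simp
  have "M *\<^sub>v v \<noteq> 0\<^sub>v b"
  proof
    assume "M *\<^sub>v v = 0\<^sub>v b"
    then have "s \<cdot>\<^sub>v v = 0\<^sub>v a" using NMv N by (simp add: mult_mat_zero_vec)
    then have "s * (v $ i) = 0" if "i < a" for i
      using that v(1) by (metis carrier_vecD index_smult_vec(1) index_zero_vec(1))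
    then have "v = 0\<^sub>v a"
      using \<open>s \<noteq> 0\<close> v(1) by (intro eq_vecI) auto
    with v(2) show False by simp
  qed
  moreover have "M * N *\<^sub>v (M *\<^sub>v v) = s \<cdot>\<^sub>v (M *\<^sub>v v)"
    using assoc_mult_mat_vec[OF M N Mv] NMv mult_mat_vec[OF M v(1)] by simp
  ultimately show ?thesis
    using mem_spectrum_iff[of "M * N" b s] M N Mv by auto
qed

text \<open>For square factors the eigenvalue 0 is also shared, since it means that one of the two factors
  is singular.\<close>

lemma spectrum_mult_commute:
  fixes M N :: "real mat"
  assumes N: "N \<in> carrier_mat k k" and M: "M \<in> carrier_mat k k"
  shows "spectrum (N * M) = spectrum (M * N)"
proof -
  have "s \<in> spectrum (M * N)"
    if s: "s \<in> spectrum (N * M)" and N: "N \<in> carrier_mat k k" and M: "M \<in> carrier_mat k k"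
    for s and M N :: "real mat"
  proof (cases "s = 0")
    case False
    then show ?thesis using nonzero_spectrum_mult_commute[OF N M s] by simp
  next
    case True
    have zero_iff: "0 \<in> spectrum X \<longleftrightarrow> det X = 0" if X: "X \<in> carrier_mat k k" for X :: "real mat"
      unfolding det_0_iff_vec_prod_zero_field[OF X] mem_spectrum_iff[OF X]
      by (auto simp: smult_vec_0)
    show ?thesis
      using s zero_iff[OF mult_carrier_mat[OF N M]] zero_iff[OF mult_carrier_mat[OF M N]]
        det_mult[OF N M] det_mult[OF M N] True by auto
  qed
  then show ?thesis using assms by blast
qed

lemma singular_values_wide:
  assumes "dim_row M \<le> dim_col M"
  shows "singular_values M = sqrt ` spectrum (M * M\<^sup>T)"
  using assms by (simp add: singular_values_def)

lemma singular_values_tall: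
  assumes "dim_col M \<le> dim_row M"
  shows "singular_values M = sqrt ` spectrum (M\<^sup>T * M)"
proof (cases "dim_col M = dim_row M")
  case True
  then have "spectrum (M * M\<^sup>T) = spectrum (M\<^sup>T * M)"
    by (intro spectrum_mult_commute[of _ "dim_row M"]) auto
  then show ?thesis by (simp add: singular_values_def)
qed (use assms in \<open>simp add: singular_values_def\<close>)

lemma singular_values_transpose: "singular_values M\<^sup>T = singular_values M"
proof (cases "dim_row M \<le> dim_col M")
  case True
  then show ?thesis by (simp add: singular_values_wide[of M] singular_values_tall[of "M\<^sup>T"])
next
  case False
  then show ?thesis by (simp add: singular_values_tall[of M] singular_values_wide[of "M\<^sup>T"])
qed

lemma scalar_prod_Gram:
  fixes M :: "real mat"
  assumes M: "M \<in> carrier_mat a b" and x: "x \<in> carrier_vec b"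
  shows "x \<bullet> (M\<^sup>T * M *\<^sub>v x) = (M *\<^sub>v x) \<bullet> (M *\<^sub>v x)"
proof -
  have "M\<^sup>T * M *\<^sub>v x = M\<^sup>T *\<^sub>v (M *\<^sub>v x)"
    using M x by (intro assoc_mult_mat_vec[of _ b a _ b]) auto
  then show ?thesis
    using scalar_prod_mult_mat_vec[of "M\<^sup>T" b a x "M *\<^sub>v x"] M x by simp
qed

lemma Gram_eigenvector:
  fixes M :: "real mat"
  assumes M: "M \<in> carrier_mat a b" and s: "s \<in> spectrum (M\<^sup>T * M)"
  obtains v where "v \<in> carrier_vec b" and "0 < v \<bullet> v" and "(M *\<^sub>v v) \<bullet> (M *\<^sub>v v) = s * (v \<bullet> v)"
proof -
  obtain v where v: "v \<in> carrier_vec b" "v \<noteq> 0\<^sub>v b" "M\<^sup>T * M *\<^sub>v v = s \<cdot>\<^sub>v v"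
    using s mem_spectrum_iff[of "M\<^sup>T * M" b s] M by auto
  then show thesis
    using that[of v] scalar_prod_self_pos[OF v(1,2)] scalar_prod_Gram[OF M v(1)] by simp
qed

lemma Gram_spectrum_nonneg:
  fixes M :: "real mat"
  assumes M: "M \<in> carrier_mat a b" and s: "s \<in> spectrum (M\<^sup>T * M)"
  shows "0 \<le> s"
proof -
  obtain v where v: "v \<in> carrier_vec b" "0 < v \<bullet> v" "(M *\<^sub>v v) \<bullet> (M *\<^sub>v v) = s * (v \<bullet> v)"
    using Gram_eigenvector[OF M s] .
  then have "0 \<le> s * (v \<bullet> v)" using scalar_prod_self_nonneg[of "M *\<^sub>v v"] by simp
  then show ?thesis using v(2) by (simp add: zero_le_mult_iff)
qed

lemma finite_singular_values: "finite (singular_values M)"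
proof -
  have "finite (spectrum (M * M\<^sup>T))" by (rule card_finite_spectrum(1)[of _ "dim_row M"]) (rule carrier_matI, simp_all)
  moreover have "finite (spectrum (M\<^sup>T * M))" by (rule card_finite_spectrum(1)[of _ "dim_col M"]) (rule carrier_matI, simp_all)
  ultimately show ?thesis by (simp add: singular_values_def)
qed

lemma singular_values_squared_tall:
  assumes M: "M \<in> carrier_mat a b" and "b \<le> a"
  shows "s \<in> singular_values M \<longleftrightarrow> 0 \<le> s \<and> s\<^sup>2 \<in> spectrum (M\<^sup>T * M)"
proof -
  have "s \<in> singular_values M \<longleftrightarrow> (\<exists>t\<in>spectrum (M\<^sup>T * M). s = sqrt t)"
    using M \<open>b \<le> a\<close> by (auto simp: singular_values_tall)
  also have "\<dots> \<longleftrightarrow> 0 \<le> s \<and> s\<^sup>2 \<in> spectrum (M\<^sup>T * M)"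
    using Gram_spectrum_nonneg[OF M] by (auto intro!: bexI[of _ "s\<^sup>2"])
  finally show ?thesis .
qed

lemma singular_values_nonneg:
  assumes "s \<in> singular_values M"
  shows "0 \<le> s"
proof (cases "dim_col M \<le> dim_row M")
  case True
  then show ?thesis using assms singular_values_squared_tall[of M "dim_row M" "dim_col M" s] by simp
next
  case False
  then show ?thesis
    using assms singular_values_squared_tall[of "M\<^sup>T" "dim_col M" "dim_row M" s]
    by (simp add: singular_values_transpose)
qed

text \<open>Both Gram matrices have the same nonzero eigenvalues, so either of them controls the singular
  values; admitting 0 makes it unnecessary to compare their kernels.\<close>

lemma singular_values_subset:
  fixes M :: "real mat"
  shows "singular_values M \<subseteq> sqrt ` insert 0 (spectrum (M * M\<^sup>T))"
proof (cases "dim_row M \<le> dim_col M")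
  case True
  then show ?thesis by (auto simp: singular_values_wide)
next
  case False
  have "spectrum (M\<^sup>T * M) \<subseteq> insert 0 (spectrum (M * M\<^sup>T))"
    using nonzero_spectrum_mult_commute[of "M\<^sup>T" "dim_col M" "dim_row M" M] by fastforce
  then show ?thesis using image_mono[of _ _ sqrt] False by (simp only: singular_values_tall)
qed

lemma min_singular_value_le:
  fixes M :: "real mat"
  assumes M: "M \<in> carrier_mat a b" and "0 < b" and "b \<le> a"
  shows "0 \<le> Min (singular_values M)"
    and "\<And>x. x \<in> carrier_vec b \<Longrightarrow> (Min (singular_values M))\<^sup>2 * (x \<bullet> x) \<le> (M *\<^sub>v x) \<bullet> (M *\<^sub>v x)"
proof -
  obtain t where t: "t \<in> spectrum (M\<^sup>T * M)"
    and bound: "\<And>x. x \<in> carrier_vec b \<Longrightarrow> t * (x \<bullet> x) \<le> x \<bullet> (M\<^sup>T * M *\<^sub>v x)"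
    using symmetric_min_eigenvalue[of "M\<^sup>T * M" b] M \<open>0 < b\<close> by (auto simp: transpose_mult[of _ b a _ b])
  have "0 \<le> t" by (rule Gram_spectrum_nonneg[OF M t])
  then have mem: "sqrt t \<in> singular_values M"
    using t singular_values_squared_tall[OF M \<open>b \<le> a\<close>] by simp
  then have "Min (singular_values M) \<in> singular_values M"
    using finite_singular_values by (intro Min_in) auto
  then show nonneg: "0 \<le> Min (singular_values M)" by (rule singular_values_nonneg)
  have "Min (singular_values M) \<le> sqrt t" using mem finite_singular_values by (intro Min_le)
  then have le: "(Min (singular_values M))\<^sup>2 \<le> t"
    using nonneg \<open>0 \<le> t\<close> by (metis power_mono real_sqrt_pow2)
  fix x :: "real vec" assume x: "x \<in> carrier_vec b"
  have "(Min (singular_values M))\<^sup>2 * (x \<bullet> x) \<le> t * (x \<bullet> x)"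
    using le scalar_prod_self_nonneg by (intro mult_right_mono)
  also have "\<dots> \<le> (M *\<^sub>v x) \<bullet> (M *\<^sub>v x)" using bound[OF x] scalar_prod_Gram[OF M x] by simp
  finally show "(Min (singular_values M))\<^sup>2 * (x \<bullet> x) \<le> (M *\<^sub>v x) \<bullet> (M *\<^sub>v x)" .
qed

text \<open>The bound says that the operator norm of \<open>M\<close> is at most some singular value.  The case with
  fewer rows than columns follows by transposition.\<close>

lemma max_singular_value_bilinear:
  fixes M :: "real mat"
  assumes M: "M \<in> carrier_mat a b" and "0 < a" and "0 < b"
  obtains s where "s \<in> singular_values M"
    and "\<And>x y. x \<in> carrier_vec a \<Longrightarrow> y \<in> carrier_vec b \<Longrightarrow>
          (x \<bullet> (M *\<^sub>v y))\<^sup>2 \<le> s\<^sup>2 * (x \<bullet> x) * (y \<bullet> y)"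
proof -
  have tall: "\<exists>s\<in>singular_values M. \<forall>x\<in>carrier_vec a. \<forall>y\<in>carrier_vec b.
      (x \<bullet> (M *\<^sub>v y))\<^sup>2 \<le> s\<^sup>2 * (x \<bullet> x) * (y \<bullet> y)"
    if M: "M \<in> carrier_mat a b" and "0 < b" and "b \<le> a" for M :: "real mat" and a b
  proof -
    obtain t where t: "t \<in> spectrum (M\<^sup>T * M)"
      and bound: "\<And>x. x \<in> carrier_vec b \<Longrightarrow> x \<bullet> (M\<^sup>T * M *\<^sub>v x) \<le> t * (x \<bullet> x)"
      using symmetric_max_eigenvalue[of "M\<^sup>T * M" b] M \<open>0 < b\<close>
      by (auto simp: transpose_mult[of _ b a _ b])
    have "0 \<le> t" by (rule Gram_spectrum_nonneg[OF M t])
    have "(x \<bullet> (M *\<^sub>v y))\<^sup>2 \<le> (sqrt t)\<^sup>2 * (x \<bullet> x) * (y \<bullet> y)"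
      if x: "x \<in> carrier_vec a" and y: "y \<in> carrier_vec b" for x y
    proof -
      have "(x \<bullet> (M *\<^sub>v y))\<^sup>2 \<le> (x \<bullet> x) * ((M *\<^sub>v y) \<bullet> (M *\<^sub>v y))"
        using x y M by (intro scalar_prod_Cauchy_Schwarz) auto
      also have "\<dots> \<le> (x \<bullet> x) * (t * (y \<bullet> y))"
        using bound[OF y] scalar_prod_Gram[OF M y] scalar_prod_self_nonneg[of x]
        by (intro mult_left_mono) auto
      finally show ?thesis using \<open>0 \<le> t\<close> by (simp add: ac_simps)
    qed
    moreover have "sqrt t \<in> singular_values M"
      using t \<open>0 \<le> t\<close> singular_values_squared_tall[OF M \<open>b \<le> a\<close>] by simp
    ultimately show ?thesis by blast
  qed
  show thesis
  proof (cases "b \<le> a")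
    case True
    then show ?thesis using tall[OF M \<open>0 < b\<close>] that by blast
  next
    case False
    then obtain s where s: "s \<in> singular_values M"
      and bound: "\<And>x y. x \<in> carrier_vec b \<Longrightarrow> y \<in> carrier_vec a \<Longrightarrow>
          (x \<bullet> (M\<^sup>T *\<^sub>v y))\<^sup>2 \<le> s\<^sup>2 * (x \<bullet> x) * (y \<bullet> y)"
      using tall[of "M\<^sup>T" b a] M \<open>0 < a\<close> by (auto simp: singular_values_transpose)
    have "(x \<bullet> (M *\<^sub>v y))\<^sup>2 \<le> s\<^sup>2 * (x \<bullet> x) * (y \<bullet> y)"
      if x: "x \<in> carrier_vec a" and y: "y \<in> carrier_vec b" for x y
    proof -
      have "x \<bullet> (M *\<^sub>v y) = y \<bullet> (M\<^sup>T *\<^sub>v x)"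
        using scalar_prod_mult_mat_vec[OF M x y] comm_scalar_prod[of "M\<^sup>T *\<^sub>v x" b y] M x y by simp
      then show ?thesis using bound[OF y x] by (simp add: ac_simps)
    qed
    then show ?thesis using that s by blast
  qed
qed

lemma singular_values_le_1:
  fixes M :: "real mat"
  assumes M: "M \<in> carrier_mat a b"
    and contr: "\<And>x. x \<in> carrier_vec b \<Longrightarrow> (M *\<^sub>v x) \<bullet> (M *\<^sub>v x) \<le> x \<bullet> x"
    and contrT: "\<And>x. x \<in> carrier_vec a \<Longrightarrow> (M\<^sup>T *\<^sub>v x) \<bullet> (M\<^sup>T *\<^sub>v x) \<le> x \<bullet> x"
    and s: "s \<in> singular_values M"
  shows "s \<le> 1"
proof -
  have tall: "s \<le> 1"
    if M: "M \<in> carrier_mat a b" and "b \<le> a" and s: "s \<in> singular_values M"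
      and contr: "\<And>x. x \<in> carrier_vec b \<Longrightarrow> (M *\<^sub>v x) \<bullet> (M *\<^sub>v x) \<le> x \<bullet> x"
    for M :: "real mat" and a b
  proof -
    have "s\<^sup>2 \<in> spectrum (M\<^sup>T * M)" using s singular_values_squared_tall[OF M \<open>b \<le> a\<close>] by simp
    then obtain v where v: "v \<in> carrier_vec b" "0 < v \<bullet> v" "(M *\<^sub>v v) \<bullet> (M *\<^sub>v v) = s\<^sup>2 * (v \<bullet> v)"
      using Gram_eigenvector[OF M] by blast
    then have "s\<^sup>2 * (v \<bullet> v) \<le> 1 * (v \<bullet> v)" using contr[OF v(1)] by simp
    then have "s\<^sup>2 \<le> 1" using v(2) by (simp add: mult_le_cancel_right)
    then show ?thesis by (simp add: power2_le_iff_abs_le abs_le_iff power_le_one_iff abs_square_le_1)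
  qed
  show ?thesis
    using tall[OF M _ s contr] tall[of "M\<^sup>T" b a] M s contrT
    by (cases "b \<le> a") (auto simp: singular_values_transpose)
qed

section \<open>Orthonormal bases and orthogonal projections\<close>

lemma mat_eq_on_vecs:
  fixes M N :: "real mat"
  assumes M: "M \<in> carrier_mat a b" and N: "N \<in> carrier_mat a b"
    and eq: "\<And>x. x \<in> carrier_vec b \<Longrightarrow> M *\<^sub>v x = N *\<^sub>v x"
  shows "M = N"
proof (rule eq_matI)
  fix i j assume "i < dim_row N" "j < dim_col N"
  then show "M $$ (i, j) = N $$ (i, j)"
    using arg_cong[OF eq[of "unit_vec b j"], of "\<lambda>v. v $ i"] M N by auto
qed (use M N in auto)

definition trace_mat :: "real mat \<Rightarrow> real" where
  "trace_mat M = (\<Sum>i\<in>{0..<dim_row M}. M $$ (i, i))"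

lemma trace_mat_mult_commute:
  assumes "M \<in> carrier_mat a b" and "N \<in> carrier_mat b a"
  shows "trace_mat (M * N) = trace_mat (N * M)"
proof -
  have "trace_mat (M * N) = (\<Sum>i\<in>{0..<a}. \<Sum>j\<in>{0..<b}. M $$ (i, j) * N $$ (j, i))"
    using assms by (simp add: trace_mat_def scalar_prod_def)
  also have "\<dots> = (\<Sum>j\<in>{0..<b}. \<Sum>i\<in>{0..<a}. N $$ (j, i) * M $$ (i, j))"
    by (subst sum.swap) (simp add: mult.commute)
  also have "\<dots> = trace_mat (N * M)"
    using assms by (simp add: trace_mat_def scalar_prod_def)
  finally show ?thesis .
qed

lemma trace_mat_one: "trace_mat (1\<^sub>m n) = real n"
  by (simp add: trace_mat_def)

lemma trace_mat_add:
  assumes "M \<in> carrier_mat n n" and "N \<in> carrier_mat n n"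
  shows "trace_mat (M + N) = trace_mat M + trace_mat N"
  using assms by (simp add: trace_mat_def sum.distrib)

lemma orthonormal_basis_matD:
  assumes "orthonormal_basis_mat n X U" and "dim_col U = k"
  shows orthonormal_basis_mat_carrier: "U \<in> carrier_mat n k"
    and orthonormal_basis_mat_orth: "U\<^sup>T * U = 1\<^sub>m k"
    and orthonormal_basis_mat_mem_iff: "x \<in> X \<longleftrightarrow> (\<exists>c\<in>carrier_vec k. x = U *\<^sub>v c)"
proof -
  show U: "U \<in> carrier_mat n k" and "U\<^sup>T * U = 1\<^sub>m k"
    using assms by (auto simp: orthonormal_basis_mat_def)
  have "X = {y \<in> carrier_vec n. \<exists>x\<in>carrier_vec k. U *\<^sub>v x = y}"
    using assms vec_space.col_space_eq[OF U] by (auto simp: orthonormal_basis_mat_def)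
  then show "x \<in> X \<longleftrightarrow> (\<exists>c\<in>carrier_vec k. x = U *\<^sub>v c)"
    using mult_mat_vec_carrier[OF U] by auto
qed

text \<open>Bessel's inequality holds because the residual \<open>x - U U\<^sup>T x\<close> has squared length
  \<open>x \<bullet> x - U\<^sup>T x \<bullet> U\<^sup>T x\<close>.\<close>

lemma orthonormal_columns:
  fixes U :: "real mat"
  assumes U: "U \<in> carrier_mat n k" and orth: "U\<^sup>T * U = 1\<^sub>m k"
  shows orthonormal_columns_isometry:
      "\<And>a b. a \<in> carrier_vec k \<Longrightarrow> b \<in> carrier_vec k \<Longrightarrow> (U *\<^sub>v a) \<bullet> (U *\<^sub>v b) = a \<bullet> b"
    and orthonormal_columns_transpose:
      "\<And>a. a \<in> carrier_vec k \<Longrightarrow> U\<^sup>T *\<^sub>v (U *\<^sub>v a) = a"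
    and orthonormal_columns_Bessel:
      "\<And>x. x \<in> carrier_vec n \<Longrightarrow> (U\<^sup>T *\<^sub>v x) \<bullet> (U\<^sup>T *\<^sub>v x) \<le> x \<bullet> x"
    and orthonormal_columns_residual:
      "\<And>x. x \<in> carrier_vec n \<Longrightarrow> U\<^sup>T *\<^sub>v (x - U *\<^sub>v (U\<^sup>T *\<^sub>v x)) = 0\<^sub>v k"
proof -
  have UT: "U\<^sup>T \<in> carrier_mat k n" using U by simp
  show tr: "U\<^sup>T *\<^sub>v (U *\<^sub>v a) = a" if "a \<in> carrier_vec k" for a
    using assoc_mult_mat_vec[OF UT U that] orth that by simp
  show iso: "(U *\<^sub>v a) \<bullet> (U *\<^sub>v b) = a \<bullet> b" if "a \<in> carrier_vec k" "b \<in> carrier_vec k" for a b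
    using scalar_prod_mult_mat_vec[OF U _ that(2), of "U *\<^sub>v a"] tr[OF that(1)] U that by simp
  fix x :: "real vec" assume x: "x \<in> carrier_vec n"
  let ?c = "U\<^sup>T *\<^sub>v x"
  have c: "?c \<in> carrier_vec k" and Uc: "U *\<^sub>v ?c \<in> carrier_vec n" using U x by auto
  show "U\<^sup>T *\<^sub>v (x - U *\<^sub>v ?c) = 0\<^sub>v k"
    using mult_minus_distrib_mat_vec[OF UT x Uc] tr[OF c] c by auto
  have xUc: "x \<bullet> (U *\<^sub>v ?c) = ?c \<bullet> ?c" using scalar_prod_mult_mat_vec[OF U x c] .
  have "0 \<le> (x - U *\<^sub>v ?c) \<bullet> (x - U *\<^sub>v ?c)" by (rule scalar_prod_self_nonneg)
  also have "\<dots> = x \<bullet> x - ?c \<bullet> ?c"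
    using x Uc xUc iso[OF c c] comm_scalar_prod[OF Uc x]
    by (simp add: minus_scalar_prod_distrib[of _ n] scalar_prod_minus_distrib[of _ n])
  finally show "?c \<bullet> ?c \<le> x \<bullet> x" by simp
qed

lemma trace_mat_orthonormal_columns:
  fixes U :: "real mat"
  assumes U: "U \<in> carrier_mat n k" and orth: "U\<^sup>T * U = 1\<^sub>m k"
  shows "trace_mat (U * U\<^sup>T) = real k"
  using trace_mat_mult_commute[of U n k "U\<^sup>T"] U orth by (simp add: trace_mat_one)

lemma trace_mat_projection:
  assumes "orthonormal_basis_mat n X U"
  shows "trace_mat (U * U\<^sup>T) = real (dim_col U)"
  by (rule trace_mat_orthonormal_columns[OF orthonormal_basis_matD(1,2)[OF assms refl]])

text \<open>The diagonal entries of \<open>U U\<^sup>T\<close> are squared lengths of the vectors \<open>U\<^sup>T e\<^sub>i\<close>, hence at most 1,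
  while their sum is the number of columns.\<close>

lemma orthonormal_columns_le:
  fixes U :: "real mat"
  assumes U: "U \<in> carrier_mat n k" and orth: "U\<^sup>T * U = 1\<^sub>m k"
  shows "k \<le> n"
proof -
  have "(U * U\<^sup>T) $$ (i, i) \<le> 1" if i: "i < n" for i
  proof -
    have "U\<^sup>T *\<^sub>v unit_vec n i = row U i"
      using U i by (intro eq_vecI) auto
    then show ?thesis
      using orthonormal_columns_Bessel[OF U orth, of "unit_vec n i"] U i by simp
  qed
  then have "(\<Sum>i\<in>{0..<n}. (U * U\<^sup>T) $$ (i, i)) \<le> (\<Sum>i\<in>{0..<n}. 1)"
    by (intro sum_mono) simp
  then have "trace_mat (U * U\<^sup>T) \<le> real n" using U by (simp add: trace_mat_def)
  then show ?thesis using trace_mat_orthonormal_columns[OF U orth] by simp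
qed

lemma projection_mult_vec:
  fixes U :: "real mat"
  assumes "U \<in> carrier_mat n k" and "x \<in> carrier_vec n"
  shows "U * U\<^sup>T *\<^sub>v x = U *\<^sub>v (U\<^sup>T *\<^sub>v x)"
  using assms by (intro assoc_mult_mat_vec[of _ n k _ n]) auto

lemma orthonormal_basis_mat_projection:
  assumes basis: "orthonormal_basis_mat n X U"
  shows "U * U\<^sup>T \<in> carrier_mat n n" and "(U * U\<^sup>T)\<^sup>T = U * U\<^sup>T"
    and "\<And>x. x \<in> carrier_vec n \<Longrightarrow> U * U\<^sup>T *\<^sub>v x \<in> X"
    and "\<And>x. x \<in> X \<Longrightarrow> U * U\<^sup>T *\<^sub>v x = x"
proof -
  obtain k where k: "dim_col U = k" by simp
  note U = orthonormal_basis_mat_carrier[OF basis k]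
  note mem_iff = orthonormal_basis_mat_mem_iff[OF basis k]
  show "U * U\<^sup>T \<in> carrier_mat n n" using U by simp
  show "(U * U\<^sup>T)\<^sup>T = U * U\<^sup>T"
    using transpose_mult[of U n k "U\<^sup>T" n] U by simp
  show "U * U\<^sup>T *\<^sub>v x = x" if "x \<in> X" for x
    using that U orthonormal_columns_transpose[OF U orthonormal_basis_mat_orth[OF basis k]]
    by (auto simp: mem_iff projection_mult_vec[OF U])
  show "U * U\<^sup>T *\<^sub>v x \<in> X" if "x \<in> carrier_vec n" for x
    using that U by (auto simp: mem_iff projection_mult_vec[OF U])
qed

text \<open>A symmetric \<open>P\<close> that fixes \<open>X\<close> and maps into \<open>X\<close> satisfies both \<open>P U U\<^sup>T = U U\<^sup>T\<close> and
  \<open>U U\<^sup>T P = P\<close>; transposing the second identity gives \<open>P U U\<^sup>T = P\<close>.\<close>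

lemma projection_unique:
  fixes P :: "real mat"
  assumes basis: "orthonormal_basis_mat n X U"
    and P: "P \<in> carrier_mat n n" and sym: "P\<^sup>T = P"
    and into: "\<And>x. x \<in> carrier_vec n \<Longrightarrow> P *\<^sub>v x \<in> X"
    and fixed: "\<And>x. x \<in> X \<Longrightarrow> P *\<^sub>v x = x"
  shows "U * U\<^sup>T = P"
proof -
  define Q where "Q = U * U\<^sup>T"
  note Q = orthonormal_basis_mat_projection[OF basis, folded Q_def]
  have "Q * P = P"
    using Q(4) into P Q(1)
    by (intro mat_eq_on_vecs[of _ n n]) (auto simp: assoc_mult_mat_vec[OF Q(1) P])
  then have "P * Q = P"
    using transpose_mult[OF Q(1) P] sym Q(2) by simp
  moreover have "P * Q = Q"
    using fixed Q(3) P Q(1)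
    by (intro mat_eq_on_vecs[of _ n n]) (auto simp: assoc_mult_mat_vec[OF P Q(1)])
  ultimately show ?thesis by (simp add: Q_def)
qed

lemma orthonormal_basis_mat_unique:
  assumes U: "orthonormal_basis_mat n X U" and V: "orthonormal_basis_mat n X V"
  shows "U * U\<^sup>T = V * V\<^sup>T" and "dim_col U = dim_col V"
proof -
  show eq: "U * U\<^sup>T = V * V\<^sup>T"
    by (intro projection_unique[OF U] orthonormal_basis_mat_projection[OF V])
  from trace_mat_projection[OF U] trace_mat_projection[OF V] eq show "dim_col U = dim_col V" by simp
qed

lemma submodule_mult_mat_vec:
  fixes U :: "real mat"
  assumes W: "submodule class_ring W (module_vec TYPE(real) n)"
    and U: "U \<in> carrier_mat n k" and cols: "set (cols U) \<subseteq> W" and c: "c \<in> carrier_vec k"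
  shows "U *\<^sub>v c \<in> W"
proof -
  interpret vec_space "TYPE(real)" n .
  have "U *\<^sub>v c \<in> col_space U" using U c by (auto simp: col_space_eq[OF U])
  also have "\<dots> \<subseteq> W" unfolding col_space_def by (rule span_is_subset[OF cols W])
  finally show ?thesis .
qed

text \<open>An orthonormal list in \<open>W\<close> of greatest length spans \<open>W\<close>: the residual of a vector of \<open>W\<close>
  outside the span would, after normalisation, extend the list.\<close>

lemma orthonormal_basis_mat_exists:
  assumes W: "submodule class_ring W (module_vec TYPE(real) n)"
  obtains U where "orthonormal_basis_mat n W U"
proof -
  interpret vec_space "TYPE(real)" n .
  have W_carrier: "W \<subseteq> carrier_vec n" using W by (simp add: submodule_def)
  have W_add: "x + y \<in> W" if "x \<in> W" "y \<in> W" for x y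
    using W that by (auto simp: submodule_def)
  have W_smult: "a \<cdot>\<^sub>v x \<in> W" if "x \<in> W" for a x
    using W that by (auto simp: submodule_def class_ring_simps)
  define orthn where "orthn us \<longleftrightarrow> set us \<subseteq> W \<and>
    (\<forall>i<length us. \<forall>j<length us. us ! i \<bullet> us ! j = (if i = j then 1 else 0))" for us :: "real vec list"
  have orth: "(mat_of_cols n us)\<^sup>T * mat_of_cols n us = 1\<^sub>m (length us)" if "orthn us" for us
    using that W_carrier by (intro eq_matI) (auto simp: orthn_def subset_iff)
  have "length us \<le> n" if "orthn us" for us
    using orthonormal_columns_le[OF mat_of_cols_carrier(1) orth[OF that]] .
  moreover have "orthn []" by (simp add: orthn_def)
  ultimately obtain us where us: "orthn us" and max: "\<And>vs. orthn vs \<Longrightarrow> length vs \<le> length us"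
    using ex_has_greatest_nat[of orthn "[]" length "n + 1"] by (auto simp: less_Suc_eq_le)
  define U where "U = mat_of_cols n us"
  have U: "U \<in> carrier_mat n (length us)" by (simp add: U_def)
  have cols_U: "cols U = us"
    using us W_carrier by (auto simp: U_def orthn_def intro!: cols_mat_of_cols)
  have into: "U *\<^sub>v c \<in> W" if "c \<in> carrier_vec (length us)" for c
    using submodule_mult_mat_vec[OF W U _ that] us by (simp add: cols_U orthn_def)
  have residual: "w - U *\<^sub>v (U\<^sup>T *\<^sub>v w) = 0\<^sub>v n" if w: "w \<in> W" for w
  proof (rule ccontr)
    let ?r = "w - U *\<^sub>v (U\<^sup>T *\<^sub>v w)"
    assume ne: "?r \<noteq> 0\<^sub>v n"
    have c: "U\<^sup>T *\<^sub>v w \<in> carrier_vec (length us)"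
      using U w W_carrier by (intro mult_mat_vec_carrier[of _ _ n]) auto
    have Uc: "U *\<^sub>v (U\<^sup>T *\<^sub>v w) \<in> W" by (rule into[OF c])
    have r_eq: "?r = w + (- 1) \<cdot>\<^sub>v (U *\<^sub>v (U\<^sup>T *\<^sub>v w))"
      using w Uc W_carrier by (intro eq_vecI) auto
    have rW: "?r \<in> W" unfolding r_eq by (intro W_add W_smult w Uc)
    then have r: "?r \<in> carrier_vec n" using W_carrier by blast
    have pos: "0 < ?r \<bullet> ?r" by (rule scalar_prod_self_pos[OF r ne])
    define v where "v = (1 / sqrt (?r \<bullet> ?r)) \<cdot>\<^sub>v ?r"
    have vW: "v \<in> W" and v: "v \<in> carrier_vec n" using rW r by (auto simp: v_def intro: W_smult)
    have "v \<bullet> v = 1" using r pos by (simp add: v_def)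
    moreover have "us ! i \<bullet> v = 0" if i: "i < length us" for i
    proof -
      have "us ! i \<in> carrier_vec n" using us W_carrier i by (auto simp: orthn_def subset_iff)
      moreover have "U\<^sup>T *\<^sub>v ?r = 0\<^sub>v (length us)"
        using orthonormal_columns_residual[OF U orth[OF us, folded U_def]] w W_carrier by blast
      moreover have "us ! i \<bullet> ?r = (U\<^sup>T *\<^sub>v ?r) $ i"
        using i \<open>us ! i \<in> carrier_vec n\<close> by (simp add: U_def)
      ultimately have "us ! i \<bullet> ?r = 0" using i by (simp only: index_zero_vec(1))
      then show ?thesis using r \<open>us ! i \<in> carrier_vec n\<close> by (simp add: v_def)
    qed
    moreover have "v \<bullet> us ! i = us ! i \<bullet> v" if i: "i < length us" for i
      using us W_carrier i v by (intro comm_scalar_prod[of _ n]) (auto simp: orthn_def subset_iff)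
    ultimately have "orthn (us @ [v])"
      using us vW by (auto simp: orthn_def nth_append less_Suc_eq)
    then show False using max[of "us @ [v]"] by simp
  qed
  have "w \<in> col_space U" if w: "w \<in> W" for w
  proof -
    have "w = U *\<^sub>v (U\<^sup>T *\<^sub>v w)"
      using w W_carrier U by (intro minus_vec_eq_0[OF _ _ residual[OF w]]) auto
    then show ?thesis
      using w W_carrier U unfolding col_space_eq[OF U]
      by (auto intro!: bexI[of _ "U\<^sup>T *\<^sub>v w"])
  qed
  moreover have "col_space U \<subseteq> W" using into U by (auto simp: col_space_eq[OF U])
  ultimately have "orthonormal_basis_mat n W U"
    using U orth[OF us] by (auto simp: orthonormal_basis_mat_def U_def)
  then show thesis by (rule that)
qed

section \<open>Principal angles of orthogonal complements\<close>

lemma add_mat_eq_one_vec: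
  fixes M N :: "real mat"
  assumes M: "M \<in> carrier_mat k k" and N: "N \<in> carrier_mat k k" and sum: "M + N = 1\<^sub>m k"
    and v: "v \<in> carrier_vec k"
  shows "M *\<^sub>v v + N *\<^sub>v v = v"
  using add_mult_distrib_mat_vec[OF M N v] sum v by simp

lemma spectrum_complementary:
  fixes M N :: "real mat"
  assumes M: "M \<in> carrier_mat k k" and N: "N \<in> carrier_mat k k" and sum: "M + N = 1\<^sub>m k"
  shows "s \<in> spectrum M \<longleftrightarrow> 1 - s \<in> spectrum N"
proof -
  have "M *\<^sub>v v = s \<cdot>\<^sub>v v \<longleftrightarrow> N *\<^sub>v v = (1 - s) \<cdot>\<^sub>v v" if v: "v \<in> carrier_vec k" for v
  proof -
    have "(M *\<^sub>v v) $ i + (N *\<^sub>v v) $ i = v $ i" if i: "i < k" for i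
    proof -
      have "(M *\<^sub>v v + N *\<^sub>v v) $ i = v $ i" by (simp only: add_mat_eq_one_vec[OF M N sum v])
      then show ?thesis using M N i by (simp del: index_mult_mat_vec)
    qed
    then have "(M *\<^sub>v v) $ i = s * v $ i \<longleftrightarrow> (N *\<^sub>v v) $ i = (1 - s) * v $ i" if "i < k" for i
      using that by (fastforce simp: left_diff_distrib)
    moreover have "w = t \<cdot>\<^sub>v v \<longleftrightarrow> (\<forall>i<k. w $ i = t * v $ i)" if "w \<in> carrier_vec k" for t and w :: "real vec"
      using that v by (auto intro!: eq_vecI)
    ultimately show ?thesis using mult_mat_vec_carrier[OF M v] mult_mat_vec_carrier[OF N v] by blast
  qed
  then show ?thesis by (auto simp: mem_spectrum_iff[OF M] mem_spectrum_iff[OF N])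
qed

lemma Gram_cross_products_complementary:
  fixes U V V' :: "real mat"
  assumes U: "U \<in> carrier_mat n a" and orth: "U\<^sup>T * U = 1\<^sub>m a"
    and V: "V \<in> carrier_mat n b" and V': "V' \<in> carrier_mat n c"
    and sum: "V * V\<^sup>T + V' * V'\<^sup>T = 1\<^sub>m n"
  shows "(U\<^sup>T * V) * (U\<^sup>T * V)\<^sup>T + (U\<^sup>T * V') * (U\<^sup>T * V')\<^sup>T = 1\<^sub>m a"
proof -
  have UT: "U\<^sup>T \<in> carrier_mat a n" using U by simp
  have conj: "(U\<^sup>T * W) * (U\<^sup>T * W)\<^sup>T = U\<^sup>T * (W * W\<^sup>T) * U" if W: "W \<in> carrier_mat n d" for W :: "real mat" and d
  proof -
    have WT: "W\<^sup>T \<in> carrier_mat d n" using W by simp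
    have UW: "U\<^sup>T * W \<in> carrier_mat a d" using UT W by (rule mult_carrier_mat)
    have "(U\<^sup>T * W) * (U\<^sup>T * W)\<^sup>T = (U\<^sup>T * W) * (W\<^sup>T * U)"
      using transpose_mult[OF UT W] by simp
    also have "\<dots> = (U\<^sup>T * W) * W\<^sup>T * U" using assoc_mult_mat[OF UW WT U] by simp
    also have "\<dots> = U\<^sup>T * (W * W\<^sup>T) * U" using assoc_mult_mat[OF UT W WT] by simp
    finally show ?thesis .
  qed
  have VV: "V * V\<^sup>T \<in> carrier_mat n n" and VV': "V' * V'\<^sup>T \<in> carrier_mat n n" using V V' by auto
  have "U\<^sup>T * (V * V\<^sup>T) * U + U\<^sup>T * (V' * V'\<^sup>T) * U = (U\<^sup>T * (V * V\<^sup>T) + U\<^sup>T * (V' * V'\<^sup>T)) * U"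
    using add_mult_distrib_mat[OF mult_carrier_mat[OF UT VV] mult_carrier_mat[OF UT VV'] U] by simp
  also have "U\<^sup>T * (V * V\<^sup>T) + U\<^sup>T * (V' * V'\<^sup>T) = U\<^sup>T * (V * V\<^sup>T + V' * V'\<^sup>T)"
    using mult_add_distrib_mat[OF UT VV VV'] by simp
  also have "\<dots> * U = 1\<^sub>m a" using sum UT orth by simp
  finally show ?thesis by (simp only: conj[OF V] conj[OF V'])
qed

text \<open>The matrices \<open>[U U']\<close> and \<open>[V V']\<close> are orthogonal, and \<open>[U U']\<^sup>T [V V']\<close> is an orthogonal
  block matrix with diagonal blocks \<open>U\<^sup>T V\<close> and \<open>U'\<^sup>T V'\<close>.  Its square off-diagonal block
  \<open>N = U\<^sup>T V'\<close> links the two: the smaller Gram matrix of \<open>U\<^sup>T V\<close> is \<open>I - N N\<^sup>T\<close> and that of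
  \<open>U'\<^sup>T V'\<close> is \<open>I - N\<^sup>T N\<close>, which have the same spectrum because \<open>N\<close> is square.  If \<open>U\<close> has more
  columns than \<open>V\<close>, the roles of the two bases are exchanged.\<close>

lemma singular_values_complementary:
  fixes U U' V V' :: "real mat"
  assumes U: "U \<in> carrier_mat n a" "U\<^sup>T * U = 1\<^sub>m a" and U': "U' \<in> carrier_mat n b" "U'\<^sup>T * U' = 1\<^sub>m b"
    and V: "V \<in> carrier_mat n b" "V\<^sup>T * V = 1\<^sub>m b" and V': "V' \<in> carrier_mat n a" "V'\<^sup>T * V' = 1\<^sub>m a"
    and sumU: "U * U\<^sup>T + U' * U'\<^sup>T = 1\<^sub>m n" and sumV: "V * V\<^sup>T + V' * V'\<^sup>T = 1\<^sub>m n"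
  shows "singular_values (U\<^sup>T * V) = singular_values (U'\<^sup>T * V')"
proof -
  have swap: "singular_values (V\<^sup>T * U) = singular_values (U\<^sup>T * V)"
    if U: "U \<in> carrier_mat n a" and V: "V \<in> carrier_mat n b" for U V :: "real mat" and a b
    using singular_values_transpose[of "U\<^sup>T * V"] transpose_mult[of "U\<^sup>T" a n V b] U V by simp
  have wide: "singular_values (U\<^sup>T * V) = singular_values (U'\<^sup>T * V')"
    if "a \<le> b"
      and U: "U \<in> carrier_mat n a" "U\<^sup>T * U = 1\<^sub>m a" and U': "U' \<in> carrier_mat n b"
      and V: "V \<in> carrier_mat n b" and V': "V' \<in> carrier_mat n a" "V'\<^sup>T * V' = 1\<^sub>m a"
      and sumU: "U * U\<^sup>T + U' * U'\<^sup>T = 1\<^sub>m n" and sumV: "V * V\<^sup>T + V' * V'\<^sup>T = 1\<^sub>m n"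
    for a b and U U' V V' :: "real mat"
  proof -
    define N where "N = U\<^sup>T * V'"
    have N: "N \<in> carrier_mat a a" using U V' by (simp add: N_def)
    have NT: "N\<^sup>T = V'\<^sup>T * U"
      using transpose_mult[of "U\<^sup>T" a n V' a] U V' by (simp add: N_def)
    have M1: "U\<^sup>T * V \<in> carrier_mat a b" and M2: "V'\<^sup>T * U' \<in> carrier_mat a b"
      using U V V' U' by auto
    have sum1: "(U\<^sup>T * V) * (U\<^sup>T * V)\<^sup>T + N * N\<^sup>T = 1\<^sub>m a"
      unfolding N_def by (rule Gram_cross_products_complementary[OF U V V'(1) sumV])
    have "U' * U'\<^sup>T + U * U\<^sup>T = 1\<^sub>m n"
      using sumU comm_add_mat[of "U * U\<^sup>T" n n "U' * U'\<^sup>T"] U U' by simp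
    from Gram_cross_products_complementary[OF V' U' U(1) this]
    have sum2: "(V'\<^sup>T * U') * (V'\<^sup>T * U')\<^sup>T + N\<^sup>T * N = 1\<^sub>m a"
      by (simp only: NT[symmetric] transpose_transpose)
    have NN: "N * N\<^sup>T \<in> carrier_mat a a" "N\<^sup>T * N \<in> carrier_mat a a" using N by auto
    have GG: "(U\<^sup>T * V) * (U\<^sup>T * V)\<^sup>T \<in> carrier_mat a a" "(V'\<^sup>T * U') * (V'\<^sup>T * U')\<^sup>T \<in> carrier_mat a a"
      using M1 M2 by auto
    have "spectrum (N * N\<^sup>T) = spectrum (N\<^sup>T * N)"
      using N by (intro spectrum_mult_commute[of _ a]) auto
    then have "spectrum ((U\<^sup>T * V) * (U\<^sup>T * V)\<^sup>T) = spectrum ((V'\<^sup>T * U') * (V'\<^sup>T * U')\<^sup>T)"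
      using spectrum_complementary[OF GG(1) NN(1) sum1] spectrum_complementary[OF GG(2) NN(2) sum2]
      by blast
    moreover have "dim_row (U\<^sup>T * V) \<le> dim_col (U\<^sup>T * V)" "dim_row (V'\<^sup>T * U') \<le> dim_col (V'\<^sup>T * U')"
      using U V U' V' \<open>a \<le> b\<close> by auto
    ultimately have "singular_values (U\<^sup>T * V) = singular_values (V'\<^sup>T * U')"
      by (simp only: singular_values_wide)
    then show ?thesis using swap[OF U' V'(1)] by simp
  qed
  show ?thesis
  proof (cases "a \<le> b")
    case True
    then show ?thesis by (rule wide[OF _ U U'(1) V(1) V' sumU sumV])
  next
    case False
    then have "singular_values (V\<^sup>T * U) = singular_values (V'\<^sup>T * U')"
      by (intro wide[OF _ V V'(1) U(1) U' sumV sumU]) simp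
    then show ?thesis by (simp only: swap[OF U(1) V(1)] swap[OF U'(1) V'(1)])
  qed
qed

text \<open>The bases range over infinitely many choices; the set is finite because every nonzero squared
  cosine is an eigenvalue of the product of the two orthogonal projections.\<close>

lemma finite_principal_angles:
  assumes X: "orthonormal_basis_mat n X U" and Y: "orthonormal_basis_mat n Y V"
  shows "finite (principal_angles n X Y)"
proof -
  define S where "S = spectrum ((V * V\<^sup>T) * (U * U\<^sup>T))"
  have VV: "V * V\<^sup>T \<in> carrier_mat n n" and UU: "U * U\<^sup>T \<in> carrier_mat n n"
    by (rule orthonormal_basis_mat_projection(1)[OF Y], rule orthonormal_basis_mat_projection(1)[OF X])
  have sub: "singular_values (U1\<^sup>T * V1) \<subseteq> sqrt ` insert 0 S"
    if X1: "orthonormal_basis_mat n X U1" and Y1: "orthonormal_basis_mat n Y V1" for U1 V1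
  proof -
    obtain a b where ab: "dim_col U1 = a" "dim_col V1 = b" by simp
    note U1 = orthonormal_basis_mat_carrier[OF X1 ab(1)]
    note V1 = orthonormal_basis_mat_carrier[OF Y1 ab(2)]
    have U1T: "U1\<^sup>T \<in> carrier_mat a n" and V1T: "V1\<^sup>T \<in> carrier_mat b n" using U1 V1 by auto
    have QU: "V1 * V1\<^sup>T * U1 \<in> carrier_mat n a" using U1 V1 by auto
    have "(U1\<^sup>T * V1) * (U1\<^sup>T * V1)\<^sup>T = U1\<^sup>T * V1 * (V1\<^sup>T * U1)"
      using transpose_mult[OF U1T V1] by simp
    also have "\<dots> = U1\<^sup>T * (V1 * V1\<^sup>T * U1)"
      using assoc_mult_mat[OF U1T V1 mult_carrier_mat[OF V1T U1]] assoc_mult_mat[OF V1 V1T U1] by simp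
    finally have Gram: "(U1\<^sup>T * V1) * (U1\<^sup>T * V1)\<^sup>T = U1\<^sup>T * (V1 * V1\<^sup>T * U1)" .
    have "V1 * V1\<^sup>T * U1 * U1\<^sup>T = (V * V\<^sup>T) * (U * U\<^sup>T)"
      using assoc_mult_mat[OF mult_carrier_mat[OF V1 V1T] U1 U1T]
        orthonormal_basis_mat_unique(1)[OF X1 X] orthonormal_basis_mat_unique(1)[OF Y1 Y] by simp
    then have "spectrum ((U1\<^sup>T * V1) * (U1\<^sup>T * V1)\<^sup>T) \<subseteq> insert 0 S"
      using nonzero_spectrum_mult_commute[OF U1T QU] by (auto simp: Gram S_def)
    then show ?thesis using singular_values_subset[of "U1\<^sup>T * V1"] by (meson image_mono insert_subset insertI1 order_trans)
  qed
  have "principal_angles n X Y \<subseteq> arccos ` sqrt ` insert 0 S"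
  proof
    fix \<theta> assume "\<theta> \<in> principal_angles n X Y"
    then have range: "0 \<le> \<theta>" "\<theta> \<le> pi" and "cos \<theta> \<in> sqrt ` insert 0 S"
      using sub pi_gt_zero by (fastforce simp: principal_angles_def)+
    then show "\<theta> \<in> arccos ` sqrt ` insert 0 S"
      using arccos_cos[OF range] by (metis imageI)
  qed
  moreover have "finite S" unfolding S_def by (rule card_finite_spectrum(1)[OF mult_carrier_mat[OF VV UU]])
  ultimately show ?thesis by (simp add: finite_subset)
qed

text \<open>The smallest principal angle is attained by some pair of bases; for this very pair the arc cosine
  of the largest singular value is again a principal angle, so the cosine of the smallest one is
  at least that singular value.\<close>

lemma smallest_principal_angle_bounds:
  assumes X: "orthonormal_basis_mat n X U" "0 < dim_col U"
    and Y: "orthonormal_basis_mat n Y V" "0 < dim_col V"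
  defines "\<theta> \<equiv> smallest_principal_angle n X Y"
  shows "0 \<le> \<theta>" and "\<theta> \<le> pi / 2"
    and "\<And>x y. x \<in> X \<Longrightarrow> y \<in> Y \<Longrightarrow> (x \<bullet> y)\<^sup>2 \<le> (cos \<theta>)\<^sup>2 * (x \<bullet> x) * (y \<bullet> y)"
proof -
  have max: "\<exists>s. 0 \<le> s \<and> arccos s \<in> principal_angles n X Y \<and> cos (arccos s) = s \<and>
      (\<forall>x\<in>X. \<forall>y\<in>Y. (x \<bullet> y)\<^sup>2 \<le> s\<^sup>2 * (x \<bullet> x) * (y \<bullet> y))"
    if X1: "orthonormal_basis_mat n X U1" and Y1: "orthonormal_basis_mat n Y V1" for U1 V1
  proof -
    obtain a b where ab: "dim_col U1 = a" "dim_col V1 = b" by simp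
    have pos: "0 < a" "0 < b"
      using ab X(2) Y(2) orthonormal_basis_mat_unique(2)[OF X(1) X1] orthonormal_basis_mat_unique(2)[OF Y(1) Y1]
      by auto
    note U1 = orthonormal_basis_matD(1,2)[OF X1 ab(1)]
    note V1 = orthonormal_basis_matD(1,2)[OF Y1 ab(2)]
    have M: "U1\<^sup>T * V1 \<in> carrier_mat a b" using U1 V1 by auto
    have M_vec: "U1\<^sup>T * V1 *\<^sub>v y = U1\<^sup>T *\<^sub>v (V1 *\<^sub>v y)" if "y \<in> carrier_vec b" for y
      using that U1 V1 by (intro assoc_mult_mat_vec[of _ a n _ b]) auto
    have MT_vec: "(U1\<^sup>T * V1)\<^sup>T *\<^sub>v x = V1\<^sup>T *\<^sub>v (U1 *\<^sub>v x)" if "x \<in> carrier_vec a" for x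
    proof -
      have "(U1\<^sup>T * V1)\<^sup>T = V1\<^sup>T * U1" using transpose_mult[of "U1\<^sup>T" a n V1 b] U1 V1 by simp
      then show ?thesis using that U1 V1 by (simp add: assoc_mult_mat_vec[of _ b n _ a])
    qed
    obtain s where s: "s \<in> singular_values (U1\<^sup>T * V1)"
      and bound: "\<And>x y. x \<in> carrier_vec a \<Longrightarrow> y \<in> carrier_vec b \<Longrightarrow>
          (x \<bullet> (U1\<^sup>T * V1 *\<^sub>v y))\<^sup>2 \<le> s\<^sup>2 * (x \<bullet> x) * (y \<bullet> y)"
      using max_singular_value_bilinear[OF M pos] by blast
    have "0 \<le> s" using s by (rule singular_values_nonneg)
    have "s \<le> 1"
    proof (rule singular_values_le_1[OF M _ _ s])
      fix y :: "real vec" assume y: "y \<in> carrier_vec b"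
      then have "V1 *\<^sub>v y \<in> carrier_vec n" using V1 by auto
      from orthonormal_columns_Bessel[OF U1 this]
      show "(U1\<^sup>T * V1 *\<^sub>v y) \<bullet> (U1\<^sup>T * V1 *\<^sub>v y) \<le> y \<bullet> y"
        using orthonormal_columns_isometry[OF V1 y y] by (simp add: M_vec[OF y])
    next
      fix x :: "real vec" assume x: "x \<in> carrier_vec a"
      then have "U1 *\<^sub>v x \<in> carrier_vec n" using U1 by auto
      from orthonormal_columns_Bessel[OF V1 this]
      show "((U1\<^sup>T * V1)\<^sup>T *\<^sub>v x) \<bullet> ((U1\<^sup>T * V1)\<^sup>T *\<^sub>v x) \<le> x \<bullet> x"
        using orthonormal_columns_isometry[OF U1 x x] by (simp add: MT_vec[OF x])
    qed
    have cos: "cos (arccos s) = s" using \<open>0 \<le> s\<close> \<open>s \<le> 1\<close> by (intro cos_arccos) auto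
    have "arccos s \<in> {0..pi/2}"
      using \<open>0 \<le> s\<close> \<open>s \<le> 1\<close> arccos_lbound[of s] arccos_le_pi2[of s] by auto
    then have mem: "arccos s \<in> principal_angles n X Y"
      using X1 Y1 s cos by (auto simp: principal_angles_def)
    have "(x \<bullet> y)\<^sup>2 \<le> s\<^sup>2 * (x \<bullet> x) * (y \<bullet> y)" if xX: "x \<in> X" and yY: "y \<in> Y" for x y
    proof -
      obtain c where c: "c \<in> carrier_vec a" "x = U1 *\<^sub>v c"
        using iffD1[OF orthonormal_basis_mat_mem_iff[OF X1 ab(1)] xX] by (rule bexE)
      obtain d where d: "d \<in> carrier_vec b" "y = V1 *\<^sub>v d"
        using iffD1[OF orthonormal_basis_mat_mem_iff[OF Y1 ab(2)] yY] by (rule bexE)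
      have y: "y \<in> carrier_vec n" using d V1 by auto
      have "x \<bullet> y = c \<bullet> (U1\<^sup>T *\<^sub>v y)"
        using scalar_prod_mult_mat_vec[of "U1\<^sup>T" a n c y] c y U1 by simp
      then have "x \<bullet> y = c \<bullet> (U1\<^sup>T * V1 *\<^sub>v d)" using M_vec[OF d(1)] d(2) by simp
      moreover have "x \<bullet> x = c \<bullet> c" "y \<bullet> y = d \<bullet> d"
        using orthonormal_columns_isometry[OF U1 c(1) c(1)] orthonormal_columns_isometry[OF V1 d(1) d(1)]
          c(2) d(2) by auto
      ultimately show ?thesis using bound[OF c(1) d(1)] by simp
    qed
    then show ?thesis using \<open>0 \<le> s\<close> mem cos by blast
  qed
  have fin: "finite (principal_angles n X Y)" by (rule finite_principal_angles[OF X(1) Y(1)])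
  have "principal_angles n X Y \<noteq> {}" using max[OF X(1) Y(1)] by blast
  then have \<theta>: "\<theta> \<in> principal_angles n X Y"
    using fin unfolding \<theta>_def smallest_principal_angle_def by (intro Min_in)
  then show "0 \<le> \<theta>" "\<theta> \<le> pi / 2" by (auto simp: principal_angles_def)
  obtain U1 V1 where "orthonormal_basis_mat n X U1" "orthonormal_basis_mat n Y V1"
    using \<theta> by (auto simp: principal_angles_def)
  from max[OF this] obtain s where s: "0 \<le> s" "arccos s \<in> principal_angles n X Y" "cos (arccos s) = s"
    and bound: "\<And>x y. x \<in> X \<Longrightarrow> y \<in> Y \<Longrightarrow> (x \<bullet> y)\<^sup>2 \<le> s\<^sup>2 * (x \<bullet> x) * (y \<bullet> y)"
    by blast
  have "\<theta> \<le> arccos s" unfolding \<theta>_def smallest_principal_angle_def by (rule Min_le[OF fin s(2)])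
  moreover have "arccos s \<le> pi" using s(2) pi_gt_zero by (auto simp: principal_angles_def)
  ultimately have "s \<le> cos \<theta>"
    using cos_monotone_0_pi_le[of \<theta> "arccos s"] \<open>0 \<le> \<theta>\<close> s(3) by simp
  then have "s\<^sup>2 \<le> (cos \<theta>)\<^sup>2" using s(1) by (simp add: power_mono)
  fix x y assume "x \<in> X" "y \<in> Y"
  from bound[OF this] have "(x \<bullet> y)\<^sup>2 \<le> s\<^sup>2 * ((x \<bullet> x) * (y \<bullet> y))" by (simp add: mult.assoc)
  also have "\<dots> \<le> (cos \<theta>)\<^sup>2 * ((x \<bullet> x) * (y \<bullet> y))"
    using \<open>s\<^sup>2 \<le> (cos \<theta>)\<^sup>2\<close> by (intro mult_right_mono mult_nonneg_nonneg scalar_prod_self_nonneg)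
  finally show "(x \<bullet> y)\<^sup>2 \<le> (cos \<theta>)\<^sup>2 * (x \<bullet> x) * (y \<bullet> y)" by (simp add: mult.assoc)
qed

lemma principal_angles_complementary:
  assumes X: "orthonormal_basis_mat n X U" and X': "orthonormal_basis_mat n X' U'"
    and Y: "orthonormal_basis_mat n Y V" and Y': "orthonormal_basis_mat n Y' V'"
    and sumU: "U * U\<^sup>T + U' * U'\<^sup>T = 1\<^sub>m n" and sumV: "V * V\<^sup>T + V' * V'\<^sup>T = 1\<^sub>m n"
    and dims: "dim_col V' = dim_col U" "dim_col U' = dim_col V"
  shows "principal_angles n X Y = principal_angles n X' Y'"
proof -
  have sub: "principal_angles n X Y \<subseteq> principal_angles n X' Y'"
    if X: "orthonormal_basis_mat n X U" and X': "orthonormal_basis_mat n X' U'"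
      and Y: "orthonormal_basis_mat n Y V" and Y': "orthonormal_basis_mat n Y' V'"
      and sumU: "U * U\<^sup>T + U' * U'\<^sup>T = 1\<^sub>m n" and sumV: "V * V\<^sup>T + V' * V'\<^sup>T = 1\<^sub>m n"
      and dims: "dim_col V' = dim_col U" "dim_col U' = dim_col V"
    for X X' Y Y' U U' V V'
  proof
    fix \<theta> assume "\<theta> \<in> principal_angles n X Y"
    then obtain U1 V1 where \<theta>: "\<theta> \<in> {0..pi/2}" and X1: "orthonormal_basis_mat n X U1"
      and Y1: "orthonormal_basis_mat n Y V1" and cos: "cos \<theta> \<in> singular_values (U1\<^sup>T * V1)"
      by (auto simp: principal_angles_def)
    obtain a b where ab: "dim_col U = a" "dim_col V = b" by simp
    note UX = orthonormal_basis_mat_unique[OF X1 X] and VY = orthonormal_basis_mat_unique[OF Y1 Y]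
    have "singular_values (U1\<^sup>T * V1) = singular_values (U'\<^sup>T * V')"
      using UX VY sumU sumV ab dims
      by (intro singular_values_complementary[of _ n a _ b]
          orthonormal_basis_mat_carrier[OF X1] orthonormal_basis_mat_orth[OF X1]
          orthonormal_basis_mat_carrier[OF Y1] orthonormal_basis_mat_orth[OF Y1]
          orthonormal_basis_mat_carrier[OF X'] orthonormal_basis_mat_orth[OF X']
          orthonormal_basis_mat_carrier[OF Y'] orthonormal_basis_mat_orth[OF Y']) simp_all
    then show "\<theta> \<in> principal_angles n X' Y'"
      using \<theta> cos X' Y' by (auto simp: principal_angles_def)
  qed
  have comm: "W' * W'\<^sup>T + W * W\<^sup>T = 1\<^sub>m n"
    if "orthonormal_basis_mat n Z W" "orthonormal_basis_mat n Z' W'" "W * W\<^sup>T + W' * W'\<^sup>T = 1\<^sub>m n" for Z Z' W W'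
    using that comm_add_mat[of "W * W\<^sup>T" n n "W' * W'\<^sup>T"]
      orthonormal_basis_mat_projection(1)[OF that(1)] orthonormal_basis_mat_projection(1)[OF that(2)] by simp
  show ?thesis
    using sub[OF X X' Y Y' sumU sumV dims]
      sub[OF X' X Y' Y comm[OF X X' sumU] comm[OF Y Y' sumV] dims(2)[symmetric] dims(1)[symmetric]]
    by blast
qed

lemma projection_form:
  assumes W: "orthonormal_basis_mat n Z W" and x: "x \<in> carrier_vec n"
  shows "x \<bullet> (W * W\<^sup>T *\<^sub>v x) = (W * W\<^sup>T *\<^sub>v x) \<bullet> (W * W\<^sup>T *\<^sub>v x)"
proof -
  note WW = orthonormal_basis_mat_projection[OF W]
  have p: "W * W\<^sup>T *\<^sub>v x \<in> carrier_vec n" by (rule mult_mat_vec_carrier[OF WW(1) x])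
  have "(W * W\<^sup>T *\<^sub>v x) \<bullet> (W * W\<^sup>T *\<^sub>v x) = x \<bullet> (W * W\<^sup>T *\<^sub>v (W * W\<^sup>T *\<^sub>v x))"
    by (simp only: scalar_prod_mult_mat_vec[OF WW(1) x p] WW(2))
  then show ?thesis by (simp only: WW(4)[OF WW(3)[OF x]])
qed

text \<open>Let \<open>a\<close> and \<open>b\<close> be the projections of \<open>x\<close> to \<open>X'\<close> and \<open>Y'\<close>.  Then \<open>a \<bullet> a + b \<bullet> b = x \<bullet> (a + b)\<close>,
  and the angle condition gives \<open>(a + b) \<bullet> (a + b) \<le> (1 + c) (a \<bullet> a + b \<bullet> b)\<close>, so by Cauchy--Schwarz
  \<open>a \<bullet> a + b \<bullet> b \<le> (1 + c) (x \<bullet> x)\<close>.  Pythagoras turns this into a lower bound for the projections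
  to the complements.\<close>

lemma projections_lower_bound:
  assumes X: "orthonormal_basis_mat n X U" and X': "orthonormal_basis_mat n X' U'"
    and Y: "orthonormal_basis_mat n Y V" and Y': "orthonormal_basis_mat n Y' V'"
    and sumU: "U * U\<^sup>T + U' * U'\<^sup>T = 1\<^sub>m n" and sumV: "V * V\<^sup>T + V' * V'\<^sup>T = 1\<^sub>m n"
    and c: "0 \<le> c"
    and angle: "\<And>x y. x \<in> X' \<Longrightarrow> y \<in> Y' \<Longrightarrow> (x \<bullet> y)\<^sup>2 \<le> c\<^sup>2 * (x \<bullet> x) * (y \<bullet> y)"
    and x: "x \<in> carrier_vec n"
  shows "(1 - c) * (x \<bullet> x) \<le> x \<bullet> (U * U\<^sup>T *\<^sub>v x) + x \<bullet> (V * V\<^sup>T *\<^sub>v x)"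
proof -
  have split: "x \<bullet> x = x \<bullet> (W * W\<^sup>T *\<^sub>v x) + x \<bullet> (W' * W'\<^sup>T *\<^sub>v x)"
    if W: "orthonormal_basis_mat n Z W" and W': "orthonormal_basis_mat n Z' W'"
      and sum: "W * W\<^sup>T + W' * W'\<^sup>T = 1\<^sub>m n" for Z Z' W W'
  proof -
    note WW = orthonormal_basis_mat_projection(1)[OF W] and WW' = orthonormal_basis_mat_projection(1)[OF W']
    have "x \<bullet> x = x \<bullet> (W * W\<^sup>T *\<^sub>v x + W' * W'\<^sup>T *\<^sub>v x)"
      by (simp only: add_mat_eq_one_vec[OF WW WW' sum x])
    also have "\<dots> = x \<bullet> (W * W\<^sup>T *\<^sub>v x) + x \<bullet> (W' * W'\<^sup>T *\<^sub>v x)"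
      by (rule scalar_prod_add_distrib[OF x mult_mat_vec_carrier[OF WW x] mult_mat_vec_carrier[OF WW' x]])
    finally show ?thesis .
  qed
  define a where "a = U' * U'\<^sup>T *\<^sub>v x"
  define b where "b = V' * V'\<^sup>T *\<^sub>v x"
  have aX: "a \<in> X'" and bY: "b \<in> Y'"
    unfolding a_def b_def by (rule orthonormal_basis_mat_projection(3)[OF _ x], fact)+
  have a: "a \<in> carrier_vec n" and b: "b \<in> carrier_vec n"
    unfolding a_def b_def
    by (rule mult_mat_vec_carrier[OF orthonormal_basis_mat_projection(1) x], fact)+
  have xa: "x \<bullet> a = a \<bullet> a" and xb: "x \<bullet> b = b \<bullet> b"
    unfolding a_def b_def by (rule projection_form[OF _ x], fact)+
  define t where "t = a \<bullet> a + b \<bullet> b"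
  have t: "0 \<le> t" unfolding t_def by (intro add_nonneg_nonneg scalar_prod_self_nonneg)
  have "(a \<bullet> b)\<^sup>2 \<le> c\<^sup>2 * ((a \<bullet> a) * (b \<bullet> b))" using angle[OF aX bY] by (simp add: mult.assoc)
  also have "\<dots> \<le> c\<^sup>2 * (t / 2)\<^sup>2"
  proof (rule mult_left_mono)
    have "0 \<le> (a \<bullet> a - b \<bullet> b)\<^sup>2" by simp
    then show "(a \<bullet> a) * (b \<bullet> b) \<le> (t / 2)\<^sup>2"
      by (simp add: t_def power2_eq_square field_simps)
  qed simp
  also have "\<dots> = (c * (t / 2))\<^sup>2" by (simp only: power_mult_distrib)
  finally have "\<bar>a \<bullet> b\<bar> \<le> c * (t / 2)"
    using c t by (intro abs_le_square_iff[THEN iffD2, THEN order_trans[OF _ eq_refl]]) (auto)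
  then have ab: "2 * (a \<bullet> b) \<le> c * t" by simp
  have "t\<^sup>2 = (x \<bullet> (a + b))\<^sup>2"
    by (simp only: t_def scalar_prod_add_distrib[OF x a b] xa xb)
  also have "\<dots> \<le> (x \<bullet> x) * ((a + b) \<bullet> (a + b))"
    using x a b by (intro scalar_prod_Cauchy_Schwarz) auto
  also have "(a + b) \<bullet> (a + b) = t + 2 * (a \<bullet> b)"
    using a b comm_scalar_prod[OF b a]
    by (simp add: t_def add_scalar_prod_distrib[of _ n] scalar_prod_add_distrib[of _ n])
  also have "(x \<bullet> x) * (t + 2 * (a \<bullet> b)) \<le> (x \<bullet> x) * (t + c * t)"
    using ab by (intro mult_left_mono scalar_prod_self_nonneg) auto
  finally have "t * t \<le> ((1 + c) * (x \<bullet> x)) * t" by (simp add: power2_eq_square algebra_simps)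
  then have "t \<le> (1 + c) * (x \<bullet> x)"
    using t c scalar_prod_self_nonneg[of x] by (cases "t = 0") (auto simp: mult_le_cancel_right)
  moreover have "x \<bullet> x = x \<bullet> (U * U\<^sup>T *\<^sub>v x) + a \<bullet> a" "x \<bullet> x = x \<bullet> (V * V\<^sup>T *\<^sub>v x) + b \<bullet> b"
    using split[OF X X' sumU] split[OF Y Y' sumV] xa xb by (simp_all add: a_def b_def)
  ultimately show ?thesis by (simp add: t_def algebra_simps)
qed

section \<open>The row space and the kernel of a matrix of full row rank\<close>

text \<open>Full row rank makes the columns of \<open>B\<close> span \<open>\<real>\<^sup>m\<close>; a vector annihilated by \<open>B\<^sup>T\<close> is
  orthogonal to all columns, hence to itself.\<close>

lemma full_row_rank_transpose_injective:
  fixes B :: "real mat"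
  assumes B: "B \<in> carrier_mat m n" and rank: "vec_space.rank m B = m"
    and y: "y \<in> carrier_vec m" and By: "B\<^sup>T *\<^sub>v y = 0\<^sub>v n"
  shows "y = 0\<^sub>v m"
proof -
  interpret vec_space "TYPE(real)" m .
  have cols: "set (cols B) \<subseteq> carrier_vec m" using B cols_dim by blast
  obtain S where S: "finite S" "maximal S (\<lambda>T. T \<subseteq> set (cols B) \<and> lin_indpt T)"
    using maximal_exists_superset[of "set (cols B)" "\<lambda>T. T \<subseteq> set (cols B) \<and> lin_indpt T" "{}"]
      finite_lin_indpt2[of "{}"] by (auto simp: lin_dep_def)
  have sub: "S \<subseteq> set (cols B)" and indpt: "lin_indpt S" using S(2) by (auto simp: maximal_def)
  have "card S = m" using rank_card_indpt[OF B S(2)] rank by simp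
  then have "basis S"
    using sub cols indpt S(1) by (intro dim_li_is_basis) (auto simp: dim_is_n)
  then have "carrier_vec m \<subseteq> span S" by (auto simp: basis_def)
  also have "\<dots> \<subseteq> col_space B" unfolding col_space_def by (rule span_is_monotone[OF sub])
  finally have "y \<in> col_space B" using y by blast
  then obtain x where x: "x \<in> carrier_vec n" "B *\<^sub>v x = y"
    using B by (auto simp: col_space_eq[OF B])
  have "y \<bullet> y = (B\<^sup>T *\<^sub>v y) \<bullet> x" using scalar_prod_mult_mat_vec[OF B y x(1)] x(2) by simp
  also have "\<dots> = 0" using By x(1) by simp
  finally show ?thesis by (rule scalar_prod_self_eq_0[OF y])
qed

text \<open>The two bases \<open>M\<close> and \<open>U\<close> of the column space are related by \<open>U = M S\<close> and \<open>M = U R\<close>; both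
  \<open>R S\<close> and \<open>S R\<close> are identities, and their traces are the two numbers of columns.\<close>

lemma dim_orthonormal_basis_col_space:
  fixes M :: "real mat"
  assumes M: "M \<in> carrier_mat n m"
    and inj: "\<And>y. y \<in> carrier_vec m \<Longrightarrow> M *\<^sub>v y = 0\<^sub>v n \<Longrightarrow> y = 0\<^sub>v m"
    and basis: "orthonormal_basis_mat n (vec_space.col_space n M) U"
  shows "dim_col U = m"
proof -
  obtain k where k: "dim_col U = k" by simp
  note U = orthonormal_basis_mat_carrier[OF basis k] and orth = orthonormal_basis_mat_orth[OF basis k]
  have UT: "U\<^sup>T \<in> carrier_mat k n" using U by simp
  have mem: "y \<in> vec_space.col_space n M \<longleftrightarrow> (\<exists>x\<in>carrier_vec m. M *\<^sub>v x = y)" for y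
    using M by (auto simp: vec_space.col_space_eq[OF M])
  \<comment> \<open>The columns of \<open>S\<close> are coordinates of the columns of \<open>U\<close> with respect to \<open>M\<close>.\<close>
  have "\<exists>s\<in>carrier_vec m. M *\<^sub>v s = U *\<^sub>v unit_vec k j" for j
    using orthonormal_basis_mat_mem_iff[OF basis k, of "U *\<^sub>v unit_vec k j"] mem by auto
  then obtain s where s: "\<And>j. s j \<in> carrier_vec m" "\<And>j. M *\<^sub>v s j = U *\<^sub>v unit_vec k j"
    by metis
  define S where "S = mat_of_cols m (map s [0..<k])"
  have S: "S \<in> carrier_mat m k" using mat_of_cols_carrier(1)[of m "map s [0..<k]"] by (simp add: S_def)
  have MS: "M * S = U"
  proof (rule mat_col_eqI)
    fix j assume "j < dim_col U"
    then have j: "j < k" by (simp add: k)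
    have colS: "col S j = s j" using s(1) j by (simp add: S_def)
    have "col (M * S) j = M *\<^sub>v s j" using col_mult2[OF M S j] colS by simp
    also have "\<dots> = col U j" unfolding s(2) using j U by (intro eq_vecI) auto
    finally show "col (M * S) j = col U j" .
  qed (use M S U in auto)
  define R where "R = U\<^sup>T * M"
  have R: "R \<in> carrier_mat k m" unfolding R_def by (rule mult_carrier_mat[OF UT M])
  have RS: "R * S = 1\<^sub>m k" unfolding R_def using assoc_mult_mat[OF UT M S] MS orth by simp
  have "S * R *\<^sub>v y = y" if y: "y \<in> carrier_vec m" for y
  proof -
    have My: "M *\<^sub>v y \<in> carrier_vec n" by (rule mult_mat_vec_carrier[OF M y])
    have SR: "S * R \<in> carrier_mat m m" by (rule mult_carrier_mat[OF S R])
    have SRy: "S * R *\<^sub>v y \<in> carrier_vec m" by (rule mult_mat_vec_carrier[OF SR y])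
    have "M *\<^sub>v (S * R *\<^sub>v y) = M *\<^sub>v (S *\<^sub>v (R *\<^sub>v y))"
      using assoc_mult_mat_vec[OF S R y] by simp
    also have "\<dots> = U *\<^sub>v (R *\<^sub>v y)"
      using assoc_mult_mat_vec[OF M S mult_mat_vec_carrier[OF R y]] MS by simp
    also have "R *\<^sub>v y = U\<^sup>T *\<^sub>v (M *\<^sub>v y)" unfolding R_def by (rule assoc_mult_mat_vec[OF UT M y])
    also have "U *\<^sub>v (U\<^sup>T *\<^sub>v (M *\<^sub>v y)) = U * U\<^sup>T *\<^sub>v (M *\<^sub>v y)"
      by (rule projection_mult_vec[OF U My, symmetric])
    also have "\<dots> = M *\<^sub>v y"
      by (rule orthonormal_basis_mat_projection(4)[OF basis]) (use mem y in auto)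
    finally have "M *\<^sub>v (S * R *\<^sub>v y - y) = 0\<^sub>v n"
      using mult_minus_distrib_mat_vec[OF M SRy y] My by simp
    then have "S * R *\<^sub>v y - y = 0\<^sub>v m" using SRy y by (intro inj) auto
    then show ?thesis by (rule minus_vec_eq_0[OF SRy y])
  qed
  then have SR: "S * R = 1\<^sub>m m"
    using S R by (intro mat_eq_on_vecs[of _ m m]) auto
  have "real k = real m"
    using trace_mat_mult_commute[OF R S] by (simp only: RS SR trace_mat_one)
  then show ?thesis using k by simp
qed

text \<open>The trace of an orthogonal projection is the dimension of its range.\<close>

lemma dim_complementary:
  assumes X: "orthonormal_basis_mat n X U" and X': "orthonormal_basis_mat n X' U'"
    and sum: "U * U\<^sup>T + U' * U'\<^sup>T = 1\<^sub>m n"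
  shows "dim_col U + dim_col U' = n"
proof -
  from trace_mat_projection[OF X] trace_mat_projection[OF X'] have "real (dim_col U) + real (dim_col U') = real n"
    using trace_mat_add[OF orthonormal_basis_mat_projection(1)[OF X] orthonormal_basis_mat_projection(1)[OF X']]
    by (simp only: sum trace_mat_one)
  then show ?thesis by linarith
qed

lemma mult_row_space_projection:
  fixes B :: "real mat"
  assumes B: "B \<in> carrier_mat m n"
    and basis: "orthonormal_basis_mat n (vec_space.col_space n B\<^sup>T) U"
  shows "B * (U * U\<^sup>T) = B"
proof -
  note P = orthonormal_basis_mat_projection[OF basis]
  have BT: "B\<^sup>T \<in> carrier_mat n m" using B by simp
  have "U * U\<^sup>T * B\<^sup>T = B\<^sup>T"
  proof (rule mat_eq_on_vecs[OF mult_carrier_mat[OF P(1) BT] BT])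
    fix y :: "real vec" assume y: "y \<in> carrier_vec m"
    have "B\<^sup>T *\<^sub>v y \<in> vec_space.col_space n B\<^sup>T"
      using y B mult_mat_vec_carrier[OF BT y] by (auto simp: vec_space.col_space_eq[OF BT])
    then show "U * U\<^sup>T * B\<^sup>T *\<^sub>v y = B\<^sup>T *\<^sub>v y"
      using assoc_mult_mat_vec[OF P(1) BT y] P(4) by simp
  qed
  then have "(U * U\<^sup>T * B\<^sup>T)\<^sup>T = B" by simp
  then show ?thesis using transpose_mult[OF P(1) BT] P(2) by simp
qed

text \<open>\<open>I - U U\<^sup>T\<close> maps into the kernel because \<open>B U U\<^sup>T = B\<close>, and it fixes the kernel because
  the kernel is orthogonal to the rows of \<open>B\<close>; uniqueness of projections then identifies it with
  \<open>U' U'\<^sup>T\<close>.\<close>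

lemma row_space_kernel_complementary:
  fixes B :: "real mat"
  assumes B: "B \<in> carrier_mat m n"
    and row: "orthonormal_basis_mat n (vec_space.col_space n B\<^sup>T) U"
    and ker: "orthonormal_basis_mat n (mat_kernel B) U'"
  shows "U * U\<^sup>T + U' * U'\<^sup>T = 1\<^sub>m n"
proof -
  define P where "P = U * U\<^sup>T"
  note P = orthonormal_basis_mat_projection[OF row, folded P_def]
  have BP: "B * P = B" unfolding P_def by (rule mult_row_space_projection[OF B row])
  have BT: "B\<^sup>T \<in> carrier_mat n m" using B by simp
  define P' where "P' = 1\<^sub>m n - P"
  have P': "P' \<in> carrier_mat n n" unfolding P'_def by (rule minus_carrier_mat[OF P(1)])
  have P'_vec: "P' *\<^sub>v x = x - P *\<^sub>v x" if x: "x \<in> carrier_vec n" for x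
    using minus_mult_distrib_mat_vec[OF one_carrier_mat P(1) x] x by (simp add: P'_def)
  have "U' * U'\<^sup>T = P'"
  proof (rule projection_unique[OF ker P'])
    show "P'\<^sup>T = P'" using transpose_minus[OF one_carrier_mat P(1)] P(2) by (simp add: P'_def)
    show "P' *\<^sub>v x \<in> mat_kernel B" if x: "x \<in> carrier_vec n" for x
    proof (rule mat_kernelI[OF B mult_mat_vec_carrier[OF P' x]])
      have Px: "P *\<^sub>v x \<in> carrier_vec n" by (rule mult_mat_vec_carrier[OF P(1) x])
      have "B *\<^sub>v (P *\<^sub>v x) = B *\<^sub>v x" using assoc_mult_mat_vec[OF B P(1) x] BP by simp
      then show "B *\<^sub>v (P' *\<^sub>v x) = 0\<^sub>v m"
        using mult_minus_distrib_mat_vec[OF B x Px] mult_mat_vec_carrier[OF B x] by (simp add: P'_vec[OF x])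
    qed
    show "P' *\<^sub>v x = x" if "x \<in> mat_kernel B" for x
    proof -
      have x: "x \<in> carrier_vec n" and Bx: "B *\<^sub>v x = 0\<^sub>v m" using mat_kernelD[OF B that] by auto
      obtain y where y: "y \<in> carrier_vec m" "B\<^sup>T *\<^sub>v y = P *\<^sub>v x"
        using P(3)[OF x] B by (auto simp: vec_space.col_space_eq[OF BT])
      have "(P *\<^sub>v x) \<bullet> (P *\<^sub>v x) = x \<bullet> (B\<^sup>T *\<^sub>v y)"
        using projection_form[OF row x] y(2) by (simp add: P_def)
      also have "\<dots> = 0" using scalar_prod_mult_mat_vec[OF BT x y(1)] Bx y(1) by simp
      finally have "P *\<^sub>v x = 0\<^sub>v n"
        by (rule scalar_prod_self_eq_0[OF mult_mat_vec_carrier[OF P(1) x]])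
      then show ?thesis using x by (simp add: P'_vec[OF x])
    qed
  qed
  then show ?thesis using P(1) unfolding P_def[symmetric] P'_def by (intro eq_matI) auto
qed

lemma mat_kernel_submodule:
  fixes B :: "real mat"
  assumes B: "B \<in> carrier_mat m n"
  shows "submodule class_ring (mat_kernel B) (module_vec TYPE(real) n)"
proof -
  interpret vec_space "TYPE(real)" n .
  show ?thesis
    by unfold_locales
      (insert mult_add_distrib_mat_vec[OF B] mult_mat_vec[OF B] mat_kernel[OF B] mult_mat_zero_vec[OF B],
        auto simp: class_ring_simps)
qed

lemma col_space_submodule:
  fixes M :: "real mat"
  assumes M: "M \<in> carrier_mat n m"
  shows "submodule class_ring (vec_space.col_space n M) (module_vec TYPE(real) n)"
proof -
  interpret vec_space "TYPE(real)" n .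
  show ?thesis unfolding col_space_def using M cols_dim[of M] by (intro span_is_submodule) auto
qed

text \<open>For \<open>z = B\<^sup>T y\<close> the smallest singular value \<open>\<sigma>\<close> gives \<open>\<sigma>\<^sup>2 (y \<bullet> y) \<le> z \<bullet> z\<close>, and Cauchy--Schwarz
  gives \<open>(z \<bullet> z)\<^sup>2 = (B z \<bullet> y)\<^sup>2 \<le> (B z \<bullet> B z) (y \<bullet> y)\<close>.  So on the row space \<open>B\<close> stretches lengths by at
  least \<open>\<sigma>\<close>, although on all of \<open>\<real>\<^sup>n\<close> it need not.\<close>

lemma min_singular_value_row_space:
  fixes B :: "real mat"
  assumes B: "B \<in> carrier_mat m n" and "0 < m" and "m \<le> n"
    and row: "orthonormal_basis_mat n (vec_space.col_space n B\<^sup>T) U"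
    and x: "x \<in> carrier_vec n"
  shows "(Min (singular_values B))\<^sup>2 * (x \<bullet> (U * U\<^sup>T *\<^sub>v x)) \<le> (B *\<^sub>v x) \<bullet> (B *\<^sub>v x)"
proof -
  note P = orthonormal_basis_mat_projection[OF row]
  have BT: "B\<^sup>T \<in> carrier_mat n m" using B by simp
  define \<sigma> where "\<sigma> = Min (singular_values B)"
  define z where "z = U * U\<^sup>T *\<^sub>v x"
  have z: "z \<in> carrier_vec n" unfolding z_def by (rule mult_mat_vec_carrier[OF P(1) x])
  obtain y where y: "y \<in> carrier_vec m" "B\<^sup>T *\<^sub>v y = z"
    using P(3)[OF x] B by (auto simp: vec_space.col_space_eq[OF BT] z_def)
  have "B *\<^sub>v z = B * (U * U\<^sup>T) *\<^sub>v x"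
    unfolding z_def by (rule assoc_mult_mat_vec[OF B P(1) x, symmetric])
  then have Bz: "B *\<^sub>v z = B *\<^sub>v x" by (simp only: mult_row_space_projection[OF B row])
  have Bx: "B *\<^sub>v x \<in> carrier_vec m" by (rule mult_mat_vec_carrier[OF B x])
  have "z \<bullet> z = (B *\<^sub>v x) \<bullet> y" using scalar_prod_mult_mat_vec[OF BT z y(1)] y(2) Bz by simp
  then have zz: "(z \<bullet> z)\<^sup>2 \<le> ((B *\<^sub>v x) \<bullet> (B *\<^sub>v x)) * (y \<bullet> y)"
    using scalar_prod_Cauchy_Schwarz[OF Bx y(1)] by simp
  have yz: "\<sigma>\<^sup>2 * (y \<bullet> y) \<le> z \<bullet> z"
    using min_singular_value_le(2)[OF BT \<open>0 < m\<close> \<open>m \<le> n\<close> y(1)] y(2)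
    by (simp add: \<sigma>_def singular_values_transpose)
  have "\<sigma>\<^sup>2 * (z \<bullet> z) \<le> (B *\<^sub>v x) \<bullet> (B *\<^sub>v x)"
  proof (cases "z \<bullet> z = 0")
    case True
    then show ?thesis by (simp add: scalar_prod_self_nonneg)
  next
    case False
    then have pos: "0 < z \<bullet> z" using scalar_prod_self_nonneg[of z] by simp
    have "(\<sigma>\<^sup>2 * (z \<bullet> z)) * (z \<bullet> z) = \<sigma>\<^sup>2 * (z \<bullet> z)\<^sup>2" by (simp add: power2_eq_square)
    also have "\<dots> \<le> \<sigma>\<^sup>2 * (((B *\<^sub>v x) \<bullet> (B *\<^sub>v x)) * (y \<bullet> y))" using zz by (intro mult_left_mono) auto
    also have "\<dots> = ((B *\<^sub>v x) \<bullet> (B *\<^sub>v x)) * (\<sigma>\<^sup>2 * (y \<bullet> y))" by (simp add: ac_simps)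
    also have "\<dots> \<le> ((B *\<^sub>v x) \<bullet> (B *\<^sub>v x)) * (z \<bullet> z)"
      using yz by (intro mult_left_mono scalar_prod_self_nonneg)
    finally show ?thesis using pos by (simp add: mult_le_cancel_right)
  qed
  then show ?thesis using projection_form[OF row x] by (simp add: \<sigma>_def z_def)
qed

section \<open>Orthonormal eigenvectors\<close>

lemma sum_nth_distinct:
  assumes "distinct xs"
  shows "(\<Sum>l\<in>{0..<length xs}. f (xs ! l)) = sum f (set xs)"
  using sum.reindex_bij_betw[OF bij_betw_nth[OF assms refl refl], of f] by (simp add: atLeast0LessThan)

context
  fixes n :: nat and u :: "nat \<Rightarrow> real vec"
  assumes u: "\<And>i. i \<in> {1..n} \<Longrightarrow> u i \<in> carrier_vec n"
    and u_orth: "\<And>i j. i \<in> {1..n} \<Longrightarrow> j \<in> {1..n} \<Longrightarrow> u i \<bullet> u j = (if i = j then 1 else 0)"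
begin

lemma orthonormal_basis_mat_of_cols:
  assumes "distinct is" and "set is \<subseteq> {1..n}"
  shows "orthonormal_basis_mat n (span_vec n (u ` set is)) (mat_of_cols n (map u is))"
proof -
  have nth: "is ! i \<in> {1..n}" if "i < length is" for i
    using that assms(2) nth_mem by blast
  have carrier: "set (map u is) \<subseteq> carrier_vec n" using u assms(2) by auto
  have "(mat_of_cols n (map u is))\<^sup>T * mat_of_cols n (map u is) = 1\<^sub>m (length is)"
    using nth by (intro eq_matI) (auto simp: u u_orth nth_eq_iff_index_eq[OF assms(1)])
  moreover have "vec_space.col_space n (mat_of_cols n (map u is)) = span_vec n (u ` set is)"
    unfolding vec_space.col_space_def using cols_mat_of_cols[OF carrier] by simp
  ultimately show ?thesis by (simp add: orthonormal_basis_mat_def)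
qed

lemma projection_entry:
  assumes dist: "distinct is" and sub: "set is \<subseteq> {1..n}" and "a < n" and "b < n"
  defines "V \<equiv> mat_of_cols n (map u is)"
  shows "(V * V\<^sup>T) $$ (a, b) = (\<Sum>i\<in>set is. u i $ a * u i $ b)"
proof -
  have "(V * V\<^sup>T) $$ (a, b) = (\<Sum>l\<in>{0..<length is}. u (is ! l) $ a * u (is ! l) $ b)"
    using \<open>a < n\<close> \<open>b < n\<close> by (simp add: V_def scalar_prod_def mat_of_cols_index)
  also have "\<dots> = (\<Sum>i\<in>set is. u i $ a * u i $ b)"
    by (rule sum_nth_distinct[OF dist, of "\<lambda>i. u i $ a * u i $ b"])
  finally show ?thesis .
qed

lemma projection_form_sum:
  assumes dist: "distinct is" and sub: "set is \<subseteq> {1..n}"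
    and x: "x \<in> carrier_vec n" and y: "y \<in> carrier_vec n"
  defines "V \<equiv> mat_of_cols n (map u is)"
  shows "x \<bullet> (V * V\<^sup>T *\<^sub>v y) = (\<Sum>i\<in>set is. (u i \<bullet> x) * (u i \<bullet> y))"
proof -
  have V: "V \<in> carrier_mat n (length is)"
    using mat_of_cols_carrier(1)[of n "map u is"] by (simp add: V_def)
  have Vy: "V\<^sup>T *\<^sub>v y \<in> carrier_vec (length is)" using V y by (intro mult_mat_vec_carrier[of _ _ n]) auto
  have nth: "(V\<^sup>T *\<^sub>v w) $ l = u (is ! l) \<bullet> w" if "l < length is" for l w
  proof -
    have "u (is ! l) \<in> carrier_vec n" using u sub that nth_mem by blast
    then show ?thesis using that by (simp add: V_def)
  qed
  have "x \<bullet> (V * V\<^sup>T *\<^sub>v y) = (V\<^sup>T *\<^sub>v x) \<bullet> (V\<^sup>T *\<^sub>v y)"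
    by (simp only: projection_mult_vec[OF V y] scalar_prod_mult_mat_vec[OF V x Vy])
  also have "\<dots> = (\<Sum>l\<in>{0..<length is}. (V\<^sup>T *\<^sub>v x) $ l * (V\<^sup>T *\<^sub>v y) $ l)"
    using V by (simp add: scalar_prod_def del: index_mult_mat_vec)
  also have "\<dots> = (\<Sum>l\<in>{0..<length is}. (u (is ! l) \<bullet> x) * (u (is ! l) \<bullet> y))"
    by (intro sum.cong refl) (simp only: nth atLeastLessThan_iff)
  also have "\<dots> = (\<Sum>i\<in>set is. (u i \<bullet> x) * (u i \<bullet> y))"
    by (rule sum_nth_distinct[OF dist, of "\<lambda>i. (u i \<bullet> x) * (u i \<bullet> y)"])
  finally show ?thesis .
qed

text \<open>A square matrix with orthonormal columns also has orthonormal rows.\<close>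

lemma full_projection:
  defines "E \<equiv> mat_of_cols n (map u [1..<n + 1])"
  shows "E * E\<^sup>T = 1\<^sub>m n"
proof -
  have E: "E \<in> carrier_mat n n"
    using mat_of_cols_carrier(1)[of n "map u [1..<n + 1]"] by (simp add: E_def del: upt_Suc)
  have "orthonormal_basis_mat n (span_vec n (u ` set [1..<n + 1])) E"
    unfolding E_def by (rule orthonormal_basis_mat_of_cols) auto
  then have "E\<^sup>T * E = 1\<^sub>m n" using E by (intro orthonormal_basis_mat_orth) auto
  then show ?thesis using mat_mult_left_right_inverse[of "E\<^sup>T" n E] E by simp
qed

lemma Parseval:
  assumes "x \<in> carrier_vec n" and "y \<in> carrier_vec n"
  shows "x \<bullet> y = (\<Sum>i\<in>{1..n}. (u i \<bullet> x) * (u i \<bullet> y))"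
proof -
  have set: "set [1..<n + 1] = {1..n}" by auto
  show ?thesis
    using projection_form_sum[of "[1..<n + 1]" x y] assms(1) one_mult_mat_vec[OF assms(2)]
    unfolding full_projection set by (simp add: assms(2))
qed

lemma projections_complementary:
  assumes dist: "distinct is" "distinct js" and part: "set is \<union> set js = {1..n}" "set is \<inter> set js = {}"
  defines "V \<equiv> mat_of_cols n (map u is)" and "V' \<equiv> mat_of_cols n (map u js)"
  shows "V * V\<^sup>T + V' * V'\<^sup>T = 1\<^sub>m n"
proof -
  have "(V * V\<^sup>T + V' * V'\<^sup>T) $$ (a, b) = 1\<^sub>m n $$ (a, b)" if ab: "a < n" "b < n" for a b
  proof -
    have sub: "set is \<subseteq> {1..n}" "set js \<subseteq> {1..n}" using part(1) by auto
    have VV: "V * V\<^sup>T \<in> carrier_mat n n" "V' * V'\<^sup>T \<in> carrier_mat n n" by (auto simp: V_def V'_def)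
    have "(V * V\<^sup>T + V' * V'\<^sup>T) $$ (a, b) = (V * V\<^sup>T) $$ (a, b) + (V' * V'\<^sup>T) $$ (a, b)"
      using VV ab by (simp del: index_mult_mat)
    also have "\<dots> = (\<Sum>i\<in>set is. u i $ a * u i $ b) + (\<Sum>i\<in>set js. u i $ a * u i $ b)"
      unfolding V_def V'_def by (simp only: projection_entry[OF dist(1) sub(1) ab] projection_entry[OF dist(2) sub(2) ab])
    also have "\<dots> = (\<Sum>i\<in>{1..n}. u i $ a * u i $ b)"
      using sum.union_disjoint[of "set is" "set js" "\<lambda>i. u i $ a * u i $ b"] part by simp
    also have "{1..n} = set [1..<n + 1]" by auto
    also have "(\<Sum>i\<in>set [1..<n + 1]. u i $ a * u i $ b) = 1\<^sub>m n $$ (a, b)"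
      unfolding full_projection[symmetric] by (rule projection_entry[symmetric, OF _ _ ab]) auto
    finally show ?thesis .
  qed
  then show ?thesis by (intro eq_matI) (auto simp: V_def V'_def simp del: index_mult_mat(1) index_add_mat(1))
qed

text \<open>In the coordinates \<open>u i \<bullet> x\<close> the form of \<open>A\<close> is the sum of \<open>\<mu> i * (u i \<bullet> x)\<^sup>2\<close>.  Lowering the
  first \<open>k\<close> eigenvalues to \<open>\<mu> k\<close> and dropping the others, which are nonnegative, leaves the left-hand
  side.\<close>

lemma form_ge_top_eigenspace:
  fixes A :: "real mat" and \<mu> :: "nat \<Rightarrow> real"
  assumes A: "A \<in> carrier_mat n n" and sym: "A\<^sup>T = A"
    and psd: "\<And>z. z \<in> carrier_vec n \<Longrightarrow> 0 \<le> z \<bullet> (A *\<^sub>v z)"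
    and ev: "\<And>i. i \<in> {1..n} \<Longrightarrow> A *\<^sub>v u i = \<mu> i \<cdot>\<^sub>v u i"
    and mono: "\<And>i j. 1 \<le> i \<Longrightarrow> i \<le> j \<Longrightarrow> j \<le> n \<Longrightarrow> \<mu> j \<le> \<mu> i"
    and k: "k \<in> {1..n}" and x: "x \<in> carrier_vec n"
  defines "V \<equiv> mat_of_cols n (map u [1..<k + 1])"
  shows "\<mu> k * (x \<bullet> (V * V\<^sup>T *\<^sub>v x)) \<le> x \<bullet> (A *\<^sub>v x)"
proof -
  have Ax: "A *\<^sub>v x \<in> carrier_vec n" by (rule mult_mat_vec_carrier[OF A x])
  have \<mu>_nonneg: "0 \<le> \<mu> i" if i: "i \<in> {1..n}" for i
    using psd[OF u[OF i]] u[OF i] u_orth[OF i i] by (simp add: ev[OF i])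
  have coord: "u i \<bullet> (A *\<^sub>v x) = \<mu> i * (u i \<bullet> x)" if i: "i \<in> {1..n}" for i
    using scalar_prod_mult_mat_vec[OF A u[OF i] x] u[OF i] x by (simp add: sym ev[OF i])
  have "\<mu> k * (x \<bullet> (V * V\<^sup>T *\<^sub>v x)) = \<mu> k * (\<Sum>i\<in>set [1..<k + 1]. (u i \<bullet> x) * (u i \<bullet> x))"
    unfolding V_def using k by (subst projection_form_sum[OF _ _ x x]) auto
  also have "\<dots> = (\<Sum>i\<in>{1..k}. \<mu> k * (u i \<bullet> x)\<^sup>2)"
    unfolding sum_distrib_left by (intro sum.cong) (auto simp: power2_eq_square)
  also have "\<dots> \<le> (\<Sum>i\<in>{1..k}. \<mu> i * (u i \<bullet> x)\<^sup>2)"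
    using k mono by (intro sum_mono mult_right_mono) auto
  also have "\<dots> \<le> (\<Sum>i\<in>{1..n}. \<mu> i * (u i \<bullet> x)\<^sup>2)"
    using k \<mu>_nonneg by (intro sum_mono2) auto
  also have "\<dots> = x \<bullet> (A *\<^sub>v x)"
    unfolding Parseval[OF x Ax] by (intro sum.cong refl) (simp add: coord power2_eq_square)
  finally show ?thesis .
qed

end

section \<open>Positive eigenvalues of the saddle point matrix\<close>

text \<open>An eigenvector \<open>(x, y)\<close> satisfies \<open>A x + B\<^sup>T y = t x\<close> and \<open>B x = t y\<close>.  Eliminating \<open>y\<close> from the
  scalar product of the first equation with \<open>x\<close> gives a quadratic equation for \<open>t\<close>.\<close>

lemma saddle_point_eigenvalue:
  fixes A B :: "real mat"
  assumes A: "A \<in> carrier_mat n n" and B: "B \<in> carrier_mat m n"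
    and ev: "eigenvalue (four_block_mat A B\<^sup>T B (0\<^sub>m m m)) t" and "t \<noteq> 0"
  obtains x where "x \<in> carrier_vec n" and "0 < x \<bullet> x"
    and "t\<^sup>2 * (x \<bullet> x) = t * (x \<bullet> (A *\<^sub>v x)) + (B *\<^sub>v x) \<bullet> (B *\<^sub>v x)"
proof -
  have BT: "B\<^sup>T \<in> carrier_mat n m" using B by simp
  define K where "K = four_block_mat A B\<^sup>T B (0\<^sub>m m m)"
  have K: "K \<in> carrier_mat (n + m) (n + m)" unfolding K_def by (rule four_block_carrier_mat[OF A]) simp
  obtain v where v: "v \<in> carrier_vec (n + m)" "v \<noteq> 0\<^sub>v (n + m)" "K *\<^sub>v v = t \<cdot>\<^sub>v v"
    using ev K by (auto simp: eigenvalue_def eigenvector_def K_def[symmetric])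
  define x where "x = vec_first v n"
  define y where "y = vec_last v m"
  have x: "x \<in> carrier_vec n" and y: "y \<in> carrier_vec m" by (simp_all add: x_def y_def)
  have v_eq: "v = x @\<^sub>v y" unfolding x_def y_def using v(1) by simp
  have Ax: "A *\<^sub>v x \<in> carrier_vec n" and BTy: "B\<^sup>T *\<^sub>v y \<in> carrier_vec n" and Bx: "B *\<^sub>v x \<in> carrier_vec m"
    by (rule mult_mat_vec_carrier[OF A x], rule mult_mat_vec_carrier[OF BT y], rule mult_mat_vec_carrier[OF B x])
  have "(t \<cdot>\<^sub>v x) @\<^sub>v (t \<cdot>\<^sub>v y) = t \<cdot>\<^sub>v (x @\<^sub>v y)"
    using x y by (intro eq_vecI) auto
  also have "\<dots> = K *\<^sub>v v" by (simp only: v_eq[symmetric] v(3))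
  also have "\<dots> = (A *\<^sub>v x + B\<^sup>T *\<^sub>v y) @\<^sub>v (B *\<^sub>v x + 0\<^sub>m m m *\<^sub>v y)"
    unfolding v_eq K_def by (rule four_block_mat_mult_vec[OF A BT B _ x y]) simp
  also have "0\<^sub>m m m *\<^sub>v y = 0\<^sub>v m" using y by (intro eq_vecI) auto
  also have "B *\<^sub>v x + 0\<^sub>v m = B *\<^sub>v x" using Bx by simp
  finally have "(t \<cdot>\<^sub>v x) @\<^sub>v (t \<cdot>\<^sub>v y) = (A *\<^sub>v x + B\<^sup>T *\<^sub>v y) @\<^sub>v (B *\<^sub>v x)" .
  then have eq1: "A *\<^sub>v x + B\<^sup>T *\<^sub>v y = t \<cdot>\<^sub>v x" and eq2: "B *\<^sub>v x = t \<cdot>\<^sub>v y"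
    using append_vec_eq[of "t \<cdot>\<^sub>v x" n "A *\<^sub>v x + B\<^sup>T *\<^sub>v y" "t \<cdot>\<^sub>v y" "B *\<^sub>v x"] x Ax BTy by auto
  have "x \<noteq> 0\<^sub>v n"
  proof
    assume x0: "x = 0\<^sub>v n"
    then have "t \<cdot>\<^sub>v y = 0\<^sub>v m" using eq2 mult_mat_zero_vec[OF B] by simp
    then have "t * (y $ i) = 0" if "i < m" for i
      using that y by (metis carrier_vecD index_smult_vec(1) index_zero_vec(1))
    then have "y = 0\<^sub>v m" using y \<open>t \<noteq> 0\<close> by (intro eq_vecI) auto
    then have "v = 0\<^sub>v (n + m)" unfolding v_eq x0 by (intro eq_vecI) auto
    with v(2) show False by simp
  qed
  then have pos: "0 < x \<bullet> x" by (rule scalar_prod_self_pos[OF x])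
  have BxBx: "(B *\<^sub>v x) \<bullet> (B *\<^sub>v x) = t * ((B *\<^sub>v x) \<bullet> y)"
  proof -
    have "(B *\<^sub>v x) \<bullet> (B *\<^sub>v x) = (B *\<^sub>v x) \<bullet> (t \<cdot>\<^sub>v y)" by (simp only: eq2)
    also have "\<dots> = t * ((B *\<^sub>v x) \<bullet> y)" by (rule scalar_prod_smult_distrib[OF Bx y])
    finally show ?thesis .
  qed
  have "t * (x \<bullet> x) = x \<bullet> (A *\<^sub>v x + B\<^sup>T *\<^sub>v y)" using eq1 x by simp
  also have "\<dots> = x \<bullet> (A *\<^sub>v x) + (B *\<^sub>v x) \<bullet> y"
    using scalar_prod_add_distrib[OF x Ax BTy] scalar_prod_mult_mat_vec[OF BT x y] by simp
  finally have "t * (t * (x \<bullet> x)) = t * (x \<bullet> (A *\<^sub>v x) + (B *\<^sub>v x) \<bullet> y)" by simp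
  then have "t\<^sup>2 * (x \<bullet> x) = t * (x \<bullet> (A *\<^sub>v x)) + (B *\<^sub>v x) \<bullet> (B *\<^sub>v x)"
    using BxBx by (simp add: power2_eq_square algebra_simps)
  then show thesis by (rule that[OF x pos])
qed

theorem theorem8:
  fixes m n :: nat
    and A B K :: "real mat"
    and \<mu> :: "nat \<Rightarrow> real"
    and u :: "nat \<Rightarrow> real vec"
    and \<sigma>_min \<theta>_min :: real
  assumes "0 < m" and "m < n"
    and "A \<in> carrier_mat n n" and "A\<^sup>T = A" and "positive_semidefinite_mat A"
    and "n - m \<le> vec_space.rank n A" and "vec_space.rank n A \<le> n"
    and "B \<in> carrier_mat m n" and "vec_space.rank m B = m"
    and "K = four_block_mat A B\<^sup>T B (0\<^sub>m m m)" and "invertible_mat K"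
    and "\<And>i. i \<in> {1..n} \<Longrightarrow> u i \<in> carrier_vec n"
    and "\<And>i j. i \<in> {1..n} \<Longrightarrow> j \<in> {1..n} \<Longrightarrow> u i \<bullet> u j = (if i = j then 1 else 0)"
    and "span_vec n (u ` {1..n}) = carrier_vec n"
    and "\<And>i. i \<in> {1..n} \<Longrightarrow> A *\<^sub>v u i = \<mu> i \<cdot>\<^sub>v u i"
    and "\<And>i j. 1 \<le> i \<Longrightarrow> i \<le> j \<Longrightarrow> j \<le> n \<Longrightarrow> \<mu> j \<le> \<mu> i"
    and "char_poly A = (\<Prod>i\<in>{1..n}. [:- \<mu> i, 1:])"
    and "\<sigma>_min = Min (singular_values B)"
    and "\<theta>_min = smallest_principal_angle n (vec_space.col_space n B\<^sup>T) (span_vec n (u ` {1..n - m}))"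
  shows "(\<forall>x. eigenvalue K x \<and> 0 < x \<longrightarrow>
           min (\<mu> (n - m) * (1 - cos \<theta>_min)) (\<sigma>_min * sqrt (1 - cos \<theta>_min)) \<le> x) \<and>
         \<theta>_min = smallest_principal_angle n (mat_kernel B) (span_vec n (u ` {n - m + 1..n}))"
proof -
  note m = assms(1) and mn = assms(2) and A = assms(3) and B = assms(8)
    and u = assms(12) and u_orth = assms(13)
  have BT: "B\<^sup>T \<in> carrier_mat n m" using B by simp
  define X where "X = vec_space.col_space n B\<^sup>T"
  define Y where "Y = span_vec n (u ` {1..n - m})"
  define Y' where "Y' = span_vec n (u ` {n - m + 1..n})"
  obtain U where U: "orthonormal_basis_mat n X U"
    using orthonormal_basis_mat_exists[OF col_space_submodule[OF BT]] unfolding X_def by blast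
  obtain U' where U': "orthonormal_basis_mat n (mat_kernel B) U'"
    using orthonormal_basis_mat_exists[OF mat_kernel_submodule[OF B]] by blast
  have sumU: "U * U\<^sup>T + U' * U'\<^sup>T = 1\<^sub>m n"
    by (rule row_space_kernel_complementary[OF B U[unfolded X_def] U'])
  have dimU: "dim_col U = m"
    by (rule dim_orthonormal_basis_col_space[OF BT full_row_rank_transpose_injective[OF B assms(9)] U[unfolded X_def]])
  then have dimU': "dim_col U' = n - m" using dim_complementary[OF U U' sumU] by simp
  define V where "V = mat_of_cols n (map u [1..<n - m + 1])"
  define V' where "V' = mat_of_cols n (map u [n - m + 1..<n + 1])"
  have sets: "set [1..<n - m + 1] = {1..n - m}" "set [n - m + 1..<n + 1] = {n - m + 1..n}" by auto
  have V: "orthonormal_basis_mat n Y V"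
    using orthonormal_basis_mat_of_cols[OF u u_orth, of "[1..<n - m + 1]"]
    unfolding V_def Y_def sets by simp
  have V': "orthonormal_basis_mat n Y' V'"
    using orthonormal_basis_mat_of_cols[OF u u_orth, of "[n - m + 1..<n + 1]"]
    unfolding V'_def Y'_def sets by simp
  have sumV: "V * V\<^sup>T + V' * V'\<^sup>T = 1\<^sub>m n"
    unfolding V_def V'_def by (rule projections_complementary[OF u u_orth]) (use mn in auto)
  have dimV: "dim_col V = n - m" and dimV': "dim_col V' = m" using mn by (auto simp: V_def V'_def)
  have "principal_angles n X Y = principal_angles n (mat_kernel B) Y'"
    by (rule principal_angles_complementary[OF U U' V V' sumU sumV]) (simp_all add: dimU dimU' dimV dimV')
  then have \<theta>_eq: "\<theta>_min = smallest_principal_angle n (mat_kernel B) Y'"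
    unfolding assms(19) X_def[symmetric] Y_def[symmetric] smallest_principal_angle_def by simp
  have posU': "0 < dim_col U'" and posV': "0 < dim_col V'" using m mn by (simp_all add: dimU' dimV')
  note angle = smallest_principal_angle_bounds[OF U' posU' V' posV', folded \<theta>_eq]
  define c where "c = cos \<theta>_min"
  have c: "0 \<le> c" unfolding c_def using angle(1,2) by (intro cos_ge_zero) auto
  have lower: "(1 - c) * (x \<bullet> x) \<le> x \<bullet> (U * U\<^sup>T *\<^sub>v x) + x \<bullet> (V * V\<^sup>T *\<^sub>v x)" if "x \<in> carrier_vec n" for x
    by (rule projections_lower_bound[OF U U' V V' sumU sumV c angle(3)[folded c_def] that])
  have psd: "0 \<le> z \<bullet> (A *\<^sub>v z)" if "z \<in> carrier_vec n" for z
    using assms(5) that A by (simp add: positive_semidefinite_mat_def)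
  have "min (\<mu> (n - m) * (1 - c)) (\<sigma>_min * sqrt (1 - c)) \<le> t" if ev: "eigenvalue K t" and t: "0 < t" for t
  proof (rule ccontr)
    assume "\<not> min (\<mu> (n - m) * (1 - c)) (\<sigma>_min * sqrt (1 - c)) \<le> t"
    then have lt1: "t < \<mu> (n - m) * (1 - c)" and lt2: "t < \<sigma>_min * sqrt (1 - c)" by auto
    have \<sigma>: "0 \<le> \<sigma>_min"
      using min_singular_value_le(1)[OF BT m] mn by (simp add: assms(18) singular_values_transpose)
    have c1: "0 < 1 - c"
    proof (rule ccontr)
      assume "\<not> 0 < 1 - c"
      then have "\<sigma>_min * sqrt (1 - c) \<le> 0" using \<sigma> by (intro mult_nonneg_nonpos) auto
      with lt2 t show False by simp
    qed
    obtain x where x: "x \<in> carrier_vec n" and pos: "0 < x \<bullet> x"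
      and eq: "t\<^sup>2 * (x \<bullet> x) = t * (x \<bullet> (A *\<^sub>v x)) + (B *\<^sub>v x) \<bullet> (B *\<^sub>v x)"
      using saddle_point_eigenvalue[OF A B ev[unfolded assms(10)]] t by auto
    define p where "p = x \<bullet> (U * U\<^sup>T *\<^sub>v x)"
    define q where "q = x \<bullet> (V * V\<^sup>T *\<^sub>v x)"
    have p: "0 \<le> p" and q: "0 \<le> q"
      unfolding p_def q_def using projection_form[OF U x] projection_form[OF V x]
      by (simp_all add: scalar_prod_self_nonneg)
    have Bx: "\<sigma>_min\<^sup>2 * p \<le> (B *\<^sub>v x) \<bullet> (B *\<^sub>v x)"
      unfolding assms(18) p_def
      by (rule min_singular_value_row_space[OF B m _ U[unfolded X_def] x]) (use mn in simp)
    have Ax: "\<mu> (n - m) * q \<le> x \<bullet> (A *\<^sub>v x)"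
      unfolding q_def V_def
      by (rule form_ge_top_eigenspace[OF u u_orth A assms(4) psd assms(15,16) _ x]) (use m mn in auto)
    \<comment> \<open>Both coefficients \<open>t * \<mu> (n - m)\<close> and \<open>\<sigma>_min\<^sup>2\<close> in the lower bound for the right-hand side of
      \<open>eq\<close> exceed \<open>t\<^sup>2 / (1 - c)\<close>, whereas \<open>p + q\<close> is at least \<open>(1 - c) * (x \<bullet> x)\<close>.\<close>
    have "t * t < t * (\<mu> (n - m) * (1 - c))" using lt1 t by simp
    then have d1: "t\<^sup>2 / (1 - c) < t * \<mu> (n - m)" using c1 by (simp add: power2_eq_square field_simps)
    have "t\<^sup>2 < (\<sigma>_min * sqrt (1 - c))\<^sup>2" using lt2 t by (intro power_strict_mono) auto
    then have d2: "t\<^sup>2 / (1 - c) < \<sigma>_min\<^sup>2" using c1 by (simp add: power_mult_distrib field_simps)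
    have "0 < (1 - c) * (x \<bullet> x)" using c1 pos by simp
    then have pq: "0 < p + q" using lower[OF x] unfolding p_def q_def by linarith
    have "t\<^sup>2 * (x \<bullet> x) = t\<^sup>2 / (1 - c) * ((1 - c) * (x \<bullet> x))" using c1 by simp
    also have "\<dots> \<le> t\<^sup>2 / (1 - c) * (p + q)"
      using lower[OF x] c1 unfolding p_def q_def by (intro mult_left_mono) auto
    also have "\<dots> < t * \<mu> (n - m) * q + \<sigma>_min\<^sup>2 * p"
    proof (cases "q = 0")
      case True
      then have "t\<^sup>2 / (1 - c) * p < \<sigma>_min\<^sup>2 * p" using d2 pq by (intro mult_strict_right_mono) auto
      then show ?thesis using True by simp
    next
      case False
      then have "t\<^sup>2 / (1 - c) * q < t * \<mu> (n - m) * q" using d1 q by (intro mult_strict_right_mono) auto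
      moreover have "t\<^sup>2 / (1 - c) * p \<le> \<sigma>_min\<^sup>2 * p" using d2 p by (intro mult_right_mono) auto
      ultimately show ?thesis by (simp add: distrib_left)
    qed
    also have "\<dots> \<le> t * (x \<bullet> (A *\<^sub>v x)) + (B *\<^sub>v x) \<bullet> (B *\<^sub>v x)"
      using Ax Bx t by (simp add: mult.assoc add_mono)
    finally show False using eq by simp
  qed
  then show ?thesis using \<theta>_eq unfolding c_def Y'_def by blast
qed

end
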